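(* Let $(X_t)_{t\ge 0}$ be a $d$-dimensional $G$-Lévy process on a sublinear expectation space $(\Omega,\mathcal{H},\hat{\mathbb{E}})$. For each bounded Lipschitz function $\varphi\in C_{b.Lip}(\mathbb{R}^d)$, define $u(t,x)=\hat{\mathbb{E}}[\varphi(x+X_t)]$ for $(t,x)\in[0,\infty)\times\mathbb{R}^d$. Then $u$ is a viscosity solution of the equation $$\partial_t u(t,x)-G_X[u(t,x+\cdot)-u(t,x)]=0,\qquad u(0,x)=\varphi(x),$$ where $G_X[f(\cdot)]:=\lim_{\delta\downarrow 0}\hat{\mathbb{E}}[f(X_\delta)]\,\delta^{-1}$ for $f\in C_b^3(\mathbb{R}^d)$ with $f(0)=0$.
   Context: Sublinear expectation space. $\Omega$ is a set, $\mathcal{H}$ is a linear space of real functions on $\Omega$ such that $\varphi(X_1,\dots,X_n)\in\mathcal{H}$ whenever $X_1,\dots,X_n\in\mathcal{H}$ and $\varphi\in C_{Lip}(\mathbb{R}^n)$ (the Lipschitz functions); in particular $\mathcal{H}$ contains the constants. A sublinear expectation is a functional $\hat{\mathbb{E}}:\mathcal{H}\to\mathbb{R}$ with (a) $\hat{\mathbb{E}}[X]\ge\hat{\mathbb{E}}[Y]$ if $X\ge Y$; (b) $\hat{\mathbb{E}}[c]=c$ for $c\in\mathbb{R}$; (c) $\hat{\mathbb{E}}[X]-\hat{\mathbb{E}}[Y]\le\hat{\mathbb{E}}[X-Y]$; (d) $\hat{\mathbb{E}}[\lambda X]=\lambda\hat{\mathbb{E}}[X]$ for $\lambda\ge0$.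 Random vectors $X_1,X_2$ in $\mathbb{R}^n$ (with components in the respective $\mathcal{H}$'s, possibly on different spaces) are identically distributed if $\hat{\mathbb{E}}_1[\varphi(X_1)]=\hat{\mathbb{E}}_2[\varphi(X_2)]$ for all $\varphi\in C_{Lip}(\mathbb{R}^n)$. $Y\in\mathcal{H}^n$ is independent from $X\in\mathcal{H}^m$ if $\hat{\mathbb{E}}[\varphi(X,Y)]=\hat{\mathbb{E}}\big[\hat{\mathbb{E}}[\varphi(x,Y)]_{x=X}\big]$ for all $\varphi\in C_{Lip}(\mathbb{R}^m\times\mathbb{R}^n)$. Lévy process. A $d$-dimensional process is a family $(X_t)_{t\ge0}$ with $X_t\in\mathcal{H}^d$; it is càdlàg if all paths $t\mapsto X_t(\omega)$ are right-continuous with left limits. A $d$-dimensional càdlàg process is a Lévy process if (i) $X_0=0$; (ii) for all $t,s>0$, $X_{t+s}-X_t$ is independent from $(X_{t_1},\dots,X_{t_n})$ for every $n$ and $0\le t_1\le\dots\le t_n\le t$; (iii) the distribution of $X_{t+s}-X_t$ does not depend on $t$. $G$-Lévy process. A $d$-dimensional Lévy process $(X_t)$ is a $G$-Lévy process if there is a decomposition $X_t=X_t^c+X_t^d$, $t\ge0$, where $(X_t^c,X_t^d)_{t\ge0}$ is a $2d$-dimensional Lévy process with $$\lim_{t\downarrow0}\hat{\mathbb{E}}[|X_t^c|^3]t^{-1}=0,\qquad \hat{\mathbb{E}}[|X_t^d|]\le Ct\ \text{ for } t\ge0,$$ for some constant $C$. The decomposition is understood up to distribution: $(X^c,X^d)$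 may live on another sublinear expectation space, provided $(X^c_t+X^d_t)_{t\ge0}$ has the same finite-dimensional distributions as $(X_t)_{t\ge 0}$. Integrability convention: $\mathcal{H}$ (of the space carrying $(X^c,X^d)$) contains $\psi(\xi^c,\xi^d)$ whenever $\xi^c$, $\xi^d$ are finite families of values of $X^c$, $X^d$ and $\psi$ is locally Lipschitz with $|\psi(x,y)|\le K(1+|x|^3+|y|)$ for some constant $K$. Function spaces. $C_{b.Lip}(\mathbb{R}^d)$: bounded Lipschitz functions. $C_b^k(\mathbb{R}^d)$: bounded $k$-times continuously differentiable functions with bounded derivatives of all orders $\le k$. $C_b^{2,3}$: bounded functions $\psi(t,x)$ on $(0,\infty)\times\mathbb{R}^d$, twice continuously differentiable in $t$ and three times in $x$, with bounded derivatives. For a $G$-Lévy process the limit defining $G_X[f(\cdot)]$ exists for every $f\in C_b^3(\mathbb{R}^d)$ with $f(0)=0$. Viscosity solution. A bounded upper semicontinuous (lower semicontinuous) function $u$ on $[0,\infty)\times\mathbb{R}^d$ is a viscosity subsolution (supersolution) of the equation if $u(0,x)\le\varphi(x)$ ($\ge\varphi(x)$) and for each $(t,x)\in(0,\infty)\times\mathbb{R}^d$ and each $\psi\in C_b^{2,3}$ with $\psi\ge u$ ($\psi\le u$) and $\psi(t,x)=u(t,x)$ one has $\partial_t\psi(t,x)-G_X[\psi(t,x+\cdot)-\psi(t,x)]\le0$ ($\ge0$). A bounded continuous function is a viscosity solution if it is both a viscosity subsolution and a viscosity supersolution. *)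

theory Defs
  imports "HOL-Analysis.Analysis"
begin

section \<open>Sublinear expectation spaces\<close>

text \<open>
  A finite tuple of vectors of length \<open>n\<close> is encoded as a function on \<open>nat\<close> of which only the
  values at \<open>i < n\<close> matter. The distance \<open>\<Sum>i<n. norm (x i - y i)\<close> is equivalent to the Euclidean
  one on \<open>'a\<^sup>n\<close>, so \<open>lip_fun n\<close> describes the Lipschitz functions on \<open>'a\<^sup>n\<close>. In particular
  \<open>lip_fun n \<phi>\<close> forces \<open>\<phi> x\<close> to depend on \<open>x 0, \<dots>, x (n - 1)\<close> only.
\<close>

definition lip_fun :: "nat \<Rightarrow> ((nat \<Rightarrow> 'a::real_normed_vector) \<Rightarrow> real) \<Rightarrow> bool" where
  "lip_fun n \<phi> \<longleftrightarrow>
     (\<exists>L. \<forall>x y. \<bar>\<phi> x - \<phi> y\<bar> \<le> L * (\<Sum>i<n. norm (x i - y i)))"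

text \<open>
  The functional \<open>E\<close> is total in HOL; it is only constrained on \<open>H\<close>. The sample space is the
  type \<open>'w\<close>.
\<close>

locale sublinear_expectation =
  fixes H :: "('w \<Rightarrow> real) set" and E :: "('w \<Rightarrow> real) \<Rightarrow> real"
  assumes zero_closed: "(\<lambda>_. 0) \<in> H"
    and add_closed: "X \<in> H \<Longrightarrow> Y \<in> H \<Longrightarrow> (\<lambda>\<omega>. X \<omega> + Y \<omega>) \<in> H"
    and scale_closed: "X \<in> H \<Longrightarrow> (\<lambda>\<omega>. c * X \<omega>) \<in> H"
    and lip_closed: "(\<forall>i<n. Z i \<in> H) \<Longrightarrow> lip_fun n \<phi> \<Longrightarrow> (\<lambda>\<omega>. \<phi> (\<lambda>i. Z i \<omega>)) \<in> H"
    and monotone: "X \<in> H \<Longrightarrow> Y \<in> H \<Longrightarrow> (\<forall>\<omega>. Y \<omega> \<le> X \<omega>) \<Longrightarrow> E Y \<le> E X"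
    and const: "E (\<lambda>_. c) = c"
    and subadd: "X \<in> H \<Longrightarrow> Y \<in> H \<Longrightarrow> E X - E Y \<le> E (\<lambda>\<omega>. X \<omega> - Y \<omega>)"
    and pos_homogeneous: "X \<in> H \<Longrightarrow> 0 \<le> c \<Longrightarrow> E (\<lambda>\<omega>. c * X \<omega>) = c * E X"

definition random_vector :: "('w \<Rightarrow> real) set \<Rightarrow> ('w \<Rightarrow> 'a::euclidean_space) \<Rightarrow> bool" where
  "random_vector H X \<longleftrightarrow> (\<forall>b\<in>Basis. (\<lambda>\<omega>. X \<omega> \<bullet> b) \<in> H)"

definition identically_distributed ::
  "(('w \<Rightarrow> real) \<Rightarrow> real) \<Rightarrow> ('w \<Rightarrow> 'a::euclidean_space) \<Rightarrow>
   (('v \<Rightarrow> real) \<Rightarrow> real) \<Rightarrow> ('v \<Rightarrow> 'a) \<Rightarrow> bool" where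
  "identically_distributed E1 X1 E2 X2 \<longleftrightarrow>
     (\<forall>\<phi> L. L-lipschitz_on UNIV \<phi> \<longrightarrow> E1 (\<lambda>\<omega>. \<phi> (X1 \<omega>)) = E2 (\<lambda>\<omega>. \<phi> (X2 \<omega>)))"

text \<open>\<open>indep_of_tuple E Y n X\<close>: \<open>Y\<close> is independent from the tuple \<open>(X 0, \<dots>, X (n - 1))\<close>.\<close>

definition indep_of_tuple ::
  "(('w \<Rightarrow> real) \<Rightarrow> real) \<Rightarrow> ('w \<Rightarrow> 'b::euclidean_space) \<Rightarrow>
   nat \<Rightarrow> (nat \<Rightarrow> 'w \<Rightarrow> 'a::euclidean_space) \<Rightarrow> bool" where
  "indep_of_tuple E Y n X \<longleftrightarrow>
     (\<forall>\<phi> L. (\<forall>x y x' y'. \<bar>\<phi> x y - \<phi> x' y'\<bar> \<le> L * ((\<Sum>i<n. norm (x i - x' i)) + norm (y - y')))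
        \<longrightarrow> E (\<lambda>\<omega>. \<phi> (\<lambda>i. X i \<omega>) (Y \<omega>)) = E (\<lambda>\<omega>. E (\<lambda>\<omega>'. \<phi> (\<lambda>i. X i \<omega>) (Y \<omega>'))))"


section \<open>Levy processes\<close>

text \<open>Processes are functions on \<open>real\<close>; only the values at times \<open>t \<ge> 0\<close> matter.\<close>

definition cadlag :: "(real \<Rightarrow> 'w \<Rightarrow> 'a::euclidean_space) \<Rightarrow> bool" where
  "cadlag X \<longleftrightarrow>
     (\<forall>\<omega>. (\<forall>t\<ge>0. ((\<lambda>s. X s \<omega>) \<longlongrightarrow> X t \<omega>) (at_right t)) \<and>
          (\<forall>t>0. \<exists>l. ((\<lambda>s. X s \<omega>) \<longlongrightarrow> l) (at_left t)))"

definition Levy_process ::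
  "('w \<Rightarrow> real) set \<Rightarrow> (('w \<Rightarrow> real) \<Rightarrow> real) \<Rightarrow> (real \<Rightarrow> 'w \<Rightarrow> 'a::euclidean_space) \<Rightarrow> bool" where
  "Levy_process H E X \<longleftrightarrow>
     (\<forall>t\<ge>0. random_vector H (X t)) \<and>
     cadlag X \<and>
     (\<forall>\<omega>. X 0 \<omega> = 0) \<and>
     (\<forall>t>0. \<forall>s>0. \<forall>n \<tau>. mono_on {..<n} \<tau> \<and> (\<forall>i<n. 0 \<le> \<tau> i \<and> \<tau> i \<le> t) \<longrightarrow>
        indep_of_tuple E (\<lambda>\<omega>. X (t + s) \<omega> - X t \<omega>) n (\<lambda>i. X (\<tau> i))) \<and>
     (\<forall>s>0. \<forall>t\<ge>0. \<forall>t'\<ge>0.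
        identically_distributed E (\<lambda>\<omega>. X (t + s) \<omega> - X t \<omega>) E (\<lambda>\<omega>. X (t' + s) \<omega> - X t' \<omega>))"

definition same_fin_dim_distributions ::
  "(('w \<Rightarrow> real) \<Rightarrow> real) \<Rightarrow> (real \<Rightarrow> 'w \<Rightarrow> 'a::euclidean_space) \<Rightarrow>
   (('v \<Rightarrow> real) \<Rightarrow> real) \<Rightarrow> (real \<Rightarrow> 'v \<Rightarrow> 'a) \<Rightarrow> bool" where
  "same_fin_dim_distributions E1 X1 E2 X2 \<longleftrightarrow>
     (\<forall>n \<tau> \<phi>. (\<forall>i<n. 0 \<le> \<tau> i) \<and> lip_fun n \<phi> \<longrightarrow>
        E1 (\<lambda>\<omega>. \<phi> (\<lambda>i. X1 (\<tau> i) \<omega>)) = E2 (\<lambda>\<omega>. \<phi> (\<lambda>i. X2 (\<tau> i) \<omega>)))"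

text \<open>Locally Lipschitz functions on \<open>'a\<^sup>m \<times> 'b\<^sup>n\<close>, with tuples encoded as above.\<close>

definition loc_lip_fun ::
  "nat \<Rightarrow> nat \<Rightarrow> ((nat \<Rightarrow> 'a::real_normed_vector) \<Rightarrow> (nat \<Rightarrow> 'b::real_normed_vector) \<Rightarrow> real) \<Rightarrow> bool" where
  "loc_lip_fun m n \<psi> \<longleftrightarrow>
     (let D = (\<lambda>x y x' y'. (\<Sum>i<m. norm (x i - x' i)) + (\<Sum>j<n. norm (y j - y' j)))
      in \<forall>x y. \<exists>r>0. \<exists>L. \<forall>x1 y1 x2 y2. D x y x1 y1 < r \<and> D x y x2 y2 < r \<longrightarrow>
           \<bar>\<psi> x1 y1 - \<psi> x2 y2\<bar> \<le> L * D x1 y1 x2 y2)"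

definition integrability_convention ::
  "('w \<Rightarrow> real) set \<Rightarrow> (real \<Rightarrow> 'w \<Rightarrow> 'a::euclidean_space) \<Rightarrow> (real \<Rightarrow> 'w \<Rightarrow> 'a) \<Rightarrow> bool" where
  "integrability_convention H Xc Xd \<longleftrightarrow>
     (\<forall>m n \<sigma> \<tau> \<psi> K.
        (\<forall>i<m. 0 \<le> \<sigma> i) \<and> (\<forall>j<n. 0 \<le> \<tau> j) \<and> loc_lip_fun m n \<psi> \<and>
        (\<forall>x y. \<bar>\<psi> x y\<bar> \<le> K * (1 + (\<Sum>i<m. norm (x i)) ^ 3 + (\<Sum>j<n. norm (y j))))
        \<longrightarrow> (\<lambda>\<omega>. \<psi> (\<lambda>i. Xc (\<sigma> i) \<omega>) (\<lambda>j. Xd (\<tau> j) \<omega>)) \<in> H)"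

text \<open>
  The decomposition lives on a sublinear expectation space over a sample space \<open>'v\<close>, which may
  differ from the sample space \<open>'w\<close> of \<open>X\<close>. HOL cannot quantify existentially over types, so \<open>'v\<close>
  is a parameter; in a theorem having \<open>G_Levy_process TYPE('v) H E X\<close> as a hypothesis with \<open>'v\<close>
  free, the decomposition is allowed to live on an arbitrary space.
\<close>

definition G_Levy_process ::
  "'v itself \<Rightarrow> ('w \<Rightarrow> real) set \<Rightarrow> (('w \<Rightarrow> real) \<Rightarrow> real) \<Rightarrow>
   (real \<Rightarrow> 'w \<Rightarrow> 'a::euclidean_space) \<Rightarrow> bool" where
  "G_Levy_process T H E X \<longleftrightarrow>
     Levy_process H E X \<and>
     (\<exists>(H' :: ('v \<Rightarrow> real) set) E' Xc Xd.
        sublinear_expectation H' E' \<and>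
        integrability_convention H' Xc Xd \<and>
        Levy_process H' E' (\<lambda>t \<omega>. (Xc t \<omega>, Xd t \<omega>)) \<and>
        same_fin_dim_distributions E' (\<lambda>t \<omega>. Xc t \<omega> + Xd t \<omega>) E X \<and>
        ((\<lambda>t. E' (\<lambda>\<omega>. norm (Xc t \<omega>) ^ 3) / t) \<longlongrightarrow> 0) (at_right 0) \<and>
        (\<exists>C. \<forall>t\<ge>0. E' (\<lambda>\<omega>. norm (Xd t \<omega>)) \<le> C * t))"

definition G_gen ::
  "(('w \<Rightarrow> real) \<Rightarrow> real) \<Rightarrow> (real \<Rightarrow> 'w \<Rightarrow> 'a::euclidean_space) \<Rightarrow> ('a \<Rightarrow> real) \<Rightarrow> real" where
  "G_gen E X f = Lim (at_right 0) (\<lambda>\<delta>. E (\<lambda>\<omega>. f (X \<delta> \<omega>)) / \<delta>)"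


section \<open>Viscosity solutions\<close>

definition bdd_cont :: "(real \<Rightarrow> 'a::euclidean_space \<Rightarrow> real) \<Rightarrow> bool" where
  "bdd_cont \<psi> \<longleftrightarrow>
     bounded (case_prod \<psi> ` ({0<..} \<times> UNIV)) \<and> continuous_on ({0<..} \<times> UNIV) (case_prod \<psi>)"

text \<open>
  \<open>Cb_time k \<psi>\<close> and \<open>Cb_space k \<psi>\<close>: on \<open>(0,\<infinity>) \<times> 'a\<close>, all derivatives of \<open>\<psi>\<close> of order \<open>\<le> k\<close> with
  respect to \<open>t\<close>, respectively \<open>x\<close>, exist and are bounded and jointly continuous in \<open>(t, x)\<close>.
  The spatial derivatives of order \<open>k + 1\<close> are those of order \<open>k\<close> of the components of the gradient.
\<close>

primrec Cb_time :: "nat \<Rightarrow> (real \<Rightarrow> 'a::euclidean_space \<Rightarrow> real) \<Rightarrow> bool" where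
  "Cb_time 0 \<psi> \<longleftrightarrow> bdd_cont \<psi>"
| "Cb_time (Suc k) \<psi> \<longleftrightarrow> bdd_cont \<psi> \<and>
     (\<exists>D. (\<forall>t>0. \<forall>x. ((\<lambda>s. \<psi> s x) has_real_derivative D t x) (at t)) \<and> Cb_time k D)"

primrec Cb_space :: "nat \<Rightarrow> (real \<Rightarrow> 'a::euclidean_space \<Rightarrow> real) \<Rightarrow> bool" where
  "Cb_space 0 \<psi> \<longleftrightarrow> bdd_cont \<psi>"
| "Cb_space (Suc k) \<psi> \<longleftrightarrow> bdd_cont \<psi> \<and>
     (\<exists>D. (\<forall>t>0. \<forall>x. GDERIV (\<psi> t) x :> D t x) \<and> (\<forall>b\<in>Basis. Cb_space k (\<lambda>t x. D t x \<bullet> b)))"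

definition Cb23 :: "(real \<Rightarrow> 'a::euclidean_space \<Rightarrow> real) \<Rightarrow> bool" where
  "Cb23 \<psi> \<longleftrightarrow> Cb_time 2 \<psi> \<and> Cb_space 3 \<psi>"

definition usc_on :: "'a::topological_space set \<Rightarrow> ('a \<Rightarrow> real) \<Rightarrow> bool" where
  "usc_on S u \<longleftrightarrow> (\<forall>p\<in>S. \<forall>a. u p < a \<longrightarrow> (\<forall>\<^sub>F q in at p within S. u q < a))"

definition lsc_on :: "'a::topological_space set \<Rightarrow> ('a \<Rightarrow> real) \<Rightarrow> bool" where
  "lsc_on S u \<longleftrightarrow> (\<forall>p\<in>S. \<forall>a. a < u p \<longrightarrow> (\<forall>\<^sub>F q in at p within S. a < u q))"

text \<open>
  The equation is \<open>\<partial>\<^sub>t u(t,x) - G[u(t,x+\<cdot>) - u(t,x)] = 0\<close>, \<open>u(0,x) = \<phi>(x)\<close>, for a functional \<open>G\<close> on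
  functions of the jump variable.
\<close>

definition viscosity_subsolution ::
  "(('a::euclidean_space \<Rightarrow> real) \<Rightarrow> real) \<Rightarrow> ('a \<Rightarrow> real) \<Rightarrow> (real \<Rightarrow> 'a \<Rightarrow> real) \<Rightarrow> bool" where
  "viscosity_subsolution G \<phi> u \<longleftrightarrow>
     bounded (case_prod u ` ({0..} \<times> UNIV)) \<and>
     usc_on ({0..} \<times> UNIV) (case_prod u) \<and>
     (\<forall>x. u 0 x \<le> \<phi> x) \<and>
     (\<forall>t>0. \<forall>x \<psi>. Cb23 \<psi> \<and> (\<forall>s>0. \<forall>y. \<psi> s y \<ge> u s y) \<and> \<psi> t x = u t x \<longrightarrow>
        deriv (\<lambda>s. \<psi> s x) t - G (\<lambda>z. \<psi> t (x + z) - \<psi> t x) \<le> 0)"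

definition viscosity_supersolution ::
  "(('a::euclidean_space \<Rightarrow> real) \<Rightarrow> real) \<Rightarrow> ('a \<Rightarrow> real) \<Rightarrow> (real \<Rightarrow> 'a \<Rightarrow> real) \<Rightarrow> bool" where
  "viscosity_supersolution G \<phi> u \<longleftrightarrow>
     bounded (case_prod u ` ({0..} \<times> UNIV)) \<and>
     lsc_on ({0..} \<times> UNIV) (case_prod u) \<and>
     (\<forall>x. u 0 x \<ge> \<phi> x) \<and>
     (\<forall>t>0. \<forall>x \<psi>. Cb23 \<psi> \<and> (\<forall>s>0. \<forall>y. \<psi> s y \<le> u s y) \<and> \<psi> t x = u t x \<longrightarrow>
        deriv (\<lambda>s. \<psi> s x) t - G (\<lambda>z. \<psi> t (x + z) - \<psi> t x) \<ge> 0)"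

definition viscosity_solution ::
  "(('a::euclidean_space \<Rightarrow> real) \<Rightarrow> real) \<Rightarrow> ('a \<Rightarrow> real) \<Rightarrow> (real \<Rightarrow> 'a \<Rightarrow> real) \<Rightarrow> bool" where
  "viscosity_solution G \<phi> u \<longleftrightarrow>
     bounded (case_prod u ` ({0..} \<times> UNIV)) \<and>
     continuous_on ({0..} \<times> UNIV) (case_prod u) \<and>
     viscosity_subsolution G \<phi> u \<and> viscosity_supersolution G \<phi> u"

end

theory Submission
  imports Defs
begin

text \<open>
  Write \<open>T t f = E[f(X t)]\<close> for Lipschitz \<open>f\<close>. Independence and stationarity of the increments make \<open>T\<close> a
  sublinear convolution semigroup, and hence \<open>u\<close> satisfies the dynamic programming principle
  \<open>u t x = E[u (t - \<delta>) (x + X \<delta>)]\<close>. If a test function \<open>\<psi>\<close> touches \<open>u\<close> from above at \<open>(t, x)\<close>, then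
  \<open>\<psi> t x \<le> E[\<psi> (t - \<delta>) (x + X \<delta>)]\<close>; expanding in time, dividing by \<open>\<delta>\<close> and letting \<open>\<delta> \<rightarrow> 0\<close> yields
  the subsolution inequality, and symmetrically for the supersolution
  (\<open>value_is_viscosity_solution\<close>).

  The substance is that the limit defining the generator exists (\<open>generator_exists\<close>). For smooth
  \<open>f\<close> with \<open>f 0 = 0\<close> the map \<open>t \<mapsto> T t f\<close> is almost additive: the defect at \<open>(t, s)\<close> is controlled by the expectation of
  \<open>f (x + y) - f x - f y\<close>, with \<open>x\<close> the value at time \<open>t\<close> and \<open>y\<close> the next increment, of length \<open>s\<close>.
  In \<open>y\<close> this has a linear part of slope \<open>O(|x|)\<close> and a remainder \<open>O(|x| min |y| |y|\<^sup>2)\<close>. It is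
  therefore enough that linear functions and \<open>min |y| |y|\<^sup>2\<close> have expectation \<open>O(s)\<close>. Linear functions
  are exactly additive in time (\<open>drift_bound\<close>). For the other the Lipschitz function
  \<open>sqrt (1 + |y|\<^sup>2) - 1\<close> is used; its quantitative convexity makes its expectation superadditive up to a
  constant factor, and boundedness on one time interval then forces linear growth
  (\<open>soft_norm_bound\<close>). The defect is thus \<open>O(s) E|X t|\<close>, which is \<open>o(s)\<close> because \<open>E|X t| \<rightarrow> 0\<close>, and
  almost additive functions have a derivative at zero
  (\<open>almost_additive_has_right_derivative\<close>).

  The decomposition into a continuous and a jump part enters through \<open>E|X t| \<rightarrow> 0\<close>
  (\<open>G_Levy_norm_tendsto_0\<close>).
\<close>

section \<open>Almost additive functions near zero\<close>

text \<open>
  Subdivision: \<open>n\<close> steps of length \<open>s\<close> gain at least \<open>n \<kappa> c s\<close> up to an error \<open>K n s\<close>, and at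
  time \<open>n s \<approx> b\<close> the result is still at most \<open>M\<close>. The factor \<open>\<kappa> < 1\<close> accommodates functionals that
  are superadditive only up to a constant.
\<close>

lemma at_most_linear_growth:
  fixes c :: "real \<Rightarrow> real"
  assumes \<kappa>: "0 < \<kappa>" "\<kappa> \<le> 1" and K: "0 \<le> K" and M: "0 \<le> M"
    and superadd: "\<And>t s. 0 < t \<Longrightarrow> 0 < s \<Longrightarrow> t + s \<le> b \<Longrightarrow> c t + \<kappa> * c s - K * s \<le> c (t + s)"
    and bound: "\<And>t. 0 < t \<Longrightarrow> t \<le> b \<Longrightarrow> c t \<le> M"
    and s: "0 < s" "s \<le> b"
  shows "c s \<le> 2 * (M + K * b) / (\<kappa> * b) * s"
proof (cases "c s \<le> 0")
  case True
  have "0 \<le> 2 * (M + K * b) / (\<kappa> * b) * s"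
    using \<kappa> K M s by (intro mult_nonneg_nonneg divide_nonneg_nonneg add_nonneg_nonneg) auto
  with True show ?thesis by linarith
next
  case False
  have iter: "real (Suc n) * \<kappa> * c s - K * (real (Suc n) * s) \<le> c (real (Suc n) * s)"
    if "real (Suc n) * s \<le> b" for n
    using that
  proof (induction n)
    case 0
    have "\<kappa> * c s \<le> 1 * c s" using False \<kappa> by (intro mult_right_mono) auto
    moreover have "0 \<le> K * s" using K s by simp
    ultimately show ?case by simp
  next
    case (Suc n)
    have eq: "real (Suc (Suc n)) * s = real (Suc n) * s + s" by (simp add: algebra_simps)
    have "real (Suc n) * s \<le> b" using Suc.prems eq s by linarith
    from Suc.IH[OF this] superadd[of "real (Suc n) * s" s] Suc.prems s
    have "real (Suc n) * \<kappa> * c s - K * (real (Suc n) * s) + \<kappa> * c s - K * s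
        \<le> c (real (Suc n) * s + s)" unfolding eq by simp
    moreover have "real (Suc (Suc n)) * \<kappa> * c s - K * (real (Suc (Suc n)) * s)
      = real (Suc n) * \<kappa> * c s - K * (real (Suc n) * s) + \<kappa> * c s - K * s"
      by (simp add: algebra_simps)
    ultimately show ?case unfolding eq by simp
  qed
  define n where "n = nat \<lfloor>b / s\<rfloor> - 1"
  have "1 \<le> b / s" using s by simp
  then have "1 \<le> \<lfloor>b / s\<rfloor>" by simp
  then have n: "real (Suc n) = of_int \<lfloor>b / s\<rfloor>" unfolding n_def by (simp add: of_nat_diff)
  have "real (Suc n) \<le> b / s" unfolding n by simp
  then have up: "real (Suc n) * s \<le> b" using s by (simp add: field_simps)
  have "b / s < real (Suc n) + 1" unfolding n by linarith
  then have "b / s \<le> 2 * real (Suc n)" by simp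
  then have low: "b \<le> 2 * (real (Suc n) * s)" using s by (simp add: field_simps)
  have "real (Suc n) * \<kappa> * c s \<le> M + K * (real (Suc n) * s)"
    using iter[OF up] bound[of "real (Suc n) * s"] up s by simp
  also have "\<dots> \<le> M + K * b" using up K by (simp add: mult_left_mono)
  finally have *: "real (Suc n) * \<kappa> * c s \<le> M + K * b" .
  have "b * (\<kappa> * c s) \<le> 2 * (real (Suc n) * s) * (\<kappa> * c s)"
    using low False \<kappa> by (intro mult_right_mono) auto
  also have "\<dots> = 2 * s * (real (Suc n) * \<kappa> * c s)" by simp
  also have "\<dots> \<le> 2 * s * (M + K * b)" using * s by (intro mult_left_mono) auto
  finally show ?thesis using s \<kappa> by (simp add: field_simps)
qed

text \<open>
  The error \<open>\<epsilon> s\<close> of one step adds up to only \<open>\<epsilon> t\<close> over a subdivision of \<open>[0, t]\<close> into steps of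
  length \<open>\<delta>\<close>, so \<open>a \<delta> / \<delta>\<close> stays within about \<open>\<epsilon>\<close> of \<open>a t / t\<close> as \<open>\<delta> \<rightarrow> 0\<close>: the difference
  quotients are Cauchy.
\<close>

lemma almost_additive_has_right_derivative:
  fixes a :: "real \<Rightarrow> real"
  assumes add: "\<And>\<epsilon>. 0 < \<epsilon> \<Longrightarrow> \<exists>\<tau>>0. \<forall>t s. 0 < t \<and> 0 < s \<and> t + s \<le> \<tau> \<longrightarrow>
                  \<bar>a (t + s) - a t - a s\<bar> \<le> \<epsilon> * s"
    and bound: "0 < t0" "\<And>t. 0 < t \<Longrightarrow> t \<le> t0 \<Longrightarrow> \<bar>a t\<bar> \<le> M"
  shows "\<exists>l. ((\<lambda>\<delta>. a \<delta> / \<delta>) \<longlongrightarrow> l) (at_right 0)"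
proof -
  have M: "0 \<le> M" using bound(2)[of t0] bound(1) by linarith
  obtain t1 where t1: "0 < t1" "\<And>t s. 0 < t \<Longrightarrow> 0 < s \<Longrightarrow> t + s \<le> t1 \<Longrightarrow> \<bar>a (t + s) - a t - a s\<bar> \<le> 1 * s"
    using add[of 1] by auto
  define t2 where "t2 = min t0 t1"
  have t2: "0 < t2" "t2 \<le> t0" "t2 \<le> t1" using bound(1) t1 by (auto simp: t2_def)
  define B where "B = 2 * (M + 1 * t2) / (1 * t2)"
  have B0: "0 \<le> B" using M t2 unfolding B_def by simp
  have B: "\<bar>a s\<bar> \<le> B * s" if s: "0 < s" "s \<le> t2" for s
  proof -
    have "a s \<le> B * s" unfolding B_def
    proof (rule at_most_linear_growth[where c = a and b = t2])
      fix t s :: real assume "0 < t" "0 < s" "t + s \<le> t2"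
      then show "a t + 1 * a s - 1 * s \<le> a (t + s)" using t1(2)[of t s] t2 by auto
    next
      fix t assume "0 < t" "t \<le> t2" then show "a t \<le> M" using bound(2)[of t] t2 by auto
    qed (use s M in auto)
    moreover have "- a s \<le> B * s" unfolding B_def
    proof (rule at_most_linear_growth[where c = "\<lambda>s. - a s" and b = t2])
      fix t s :: real assume "0 < t" "0 < s" "t + s \<le> t2"
      then show "- a t + 1 * (- a s) - 1 * s \<le> - a (t + s)" using t1(2)[of t s] t2 by auto
    next
      fix t assume "0 < t" "t \<le> t2" then show "- a t \<le> M" using bound(2)[of t] t2 by auto
    qed (use s M in auto)
    ultimately show ?thesis by linarith
  qed
  \<comment> \<open>The final division by \<open>t\<close> turns an error of \<open>\<epsilon> t + 2 B \<delta>\<close> into \<open>2 \<epsilon>\<close> once \<open>2 B \<delta> \<le> \<epsilon> t\<close>.\<close>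
  have near: "\<exists>t>0. \<exists>d>0. \<forall>\<delta>. 0 < \<delta> \<and> \<delta> < d \<longrightarrow> \<bar>a \<delta> / \<delta> - a t / t\<bar> \<le> 2 * \<epsilon>" if \<epsilon>: "0 < \<epsilon>" for \<epsilon>
  proof -
    obtain \<tau> where \<tau>: "0 < \<tau>" "\<And>t s. 0 < t \<Longrightarrow> 0 < s \<Longrightarrow> t + s \<le> \<tau> \<Longrightarrow> \<bar>a (t + s) - a t - a s\<bar> \<le> \<epsilon> * s"
      using add[OF \<epsilon>] by auto
    define t where "t = min \<tau> t2"
    have t: "0 < t" "t \<le> \<tau>" "t \<le> t2" using \<tau> t2 by (auto simp: t_def)
    define d where "d = min t (\<epsilon> * t / (2 * B + 1))"
    have d: "0 < d" using t \<epsilon> B0 by (simp add: d_def)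
    have "\<bar>a \<delta> / \<delta> - a t / t\<bar> \<le> 2 * \<epsilon>" if \<delta>: "0 < \<delta>" "\<delta> < d" for \<delta>
    proof -
      have dt: "\<delta> < t" "\<delta> < \<epsilon> * t / (2 * B + 1)" using \<delta> by (auto simp: d_def)
      have iter: "\<bar>a (real (Suc n) * \<delta>) - real (Suc n) * a \<delta>\<bar> \<le> \<epsilon> * (real n * \<delta>)"
        if "real (Suc n) * \<delta> \<le> t" for n
        using that
      proof (induction n)
        case 0 show ?case by simp
      next
        case (Suc n)
        have eq: "real (Suc (Suc n)) * \<delta> = real (Suc n) * \<delta> + \<delta>" by (simp add: algebra_simps)
        have 1: "real (Suc n) * \<delta> \<le> t" using Suc.prems eq \<delta> by linarith
        have "real (Suc n) * \<delta> + \<delta> \<le> \<tau>" using Suc.prems eq t by linarith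
        then have "\<bar>a (real (Suc n) * \<delta> + \<delta>) - a (real (Suc n) * \<delta>) - a \<delta>\<bar> \<le> \<epsilon> * \<delta>"
          using \<tau>(2)[of "real (Suc n) * \<delta>" \<delta>] \<delta> by simp
        moreover have "real (Suc (Suc n)) * a \<delta> = real (Suc n) * a \<delta> + a \<delta>"
          "\<epsilon> * (real (Suc n) * \<delta>) = \<epsilon> * (real n * \<delta>) + \<epsilon> * \<delta>"
          by (simp_all add: algebra_simps)
        ultimately show ?case using Suc.IH[OF 1] unfolding eq by linarith
      qed
      define n where "n = nat \<lfloor>t / \<delta>\<rfloor> - 1"
      have "1 \<le> t / \<delta>" using dt \<delta> by simp
      then have "1 \<le> \<lfloor>t / \<delta>\<rfloor>" by simp
      then have n: "real (Suc n) = of_int \<lfloor>t / \<delta>\<rfloor>" unfolding n_def by (simp add: of_nat_diff)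
      have nd: "real (Suc n) \<le> t / \<delta>" unfolding n by simp
      then have up: "real (Suc n) * \<delta> \<le> t" using \<delta> by (simp add: field_simps)
      have nd': "t / \<delta> - real (Suc n) \<le> 1" unfolding n by linarith
      define r where "r = t - real (Suc n) * \<delta>"
      have r: "0 \<le> r" "r \<le> \<delta>" "t = real (Suc n) * \<delta> + r"
        using up nd' \<delta> unfolding r_def by (auto simp: field_simps)
      have rem: "\<bar>a t - a (real (Suc n) * \<delta>)\<bar> \<le> \<epsilon> * r + B * \<delta>"
      proof (cases "r = 0")
        case True then show ?thesis using r B0 \<delta> by simp
      next
        case False
        have "\<bar>a (real (Suc n) * \<delta> + r) - a (real (Suc n) * \<delta>) - a r\<bar> \<le> \<epsilon> * r"
          using \<tau>(2)[of "real (Suc n) * \<delta>" r] False r t \<delta> by simp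
        moreover have "\<bar>a r\<bar> \<le> B * r" using B[of r] False r dt t by simp
        moreover have "B * r \<le> B * \<delta>" using r B0 by (intro mult_left_mono) auto
        ultimately show ?thesis unfolding r(3)[symmetric] by linarith
      qed
      have frac: "\<bar>(t / \<delta> - real (Suc n)) * a \<delta>\<bar> \<le> B * \<delta>"
      proof -
        have "\<bar>(t / \<delta> - real (Suc n)) * a \<delta>\<bar> = (t / \<delta> - real (Suc n)) * \<bar>a \<delta>\<bar>"
          using nd by (simp add: abs_mult)
        also have "\<dots> \<le> 1 * \<bar>a \<delta>\<bar>" using nd' by (intro mult_right_mono) auto
        finally show ?thesis using B[of \<delta>] \<delta> dt t by simp
      qed
      have "real n * \<delta> + r \<le> t" using r(3) \<delta> by (simp add: algebra_simps)
      then have "\<epsilon> * (real n * \<delta>) + \<epsilon> * r \<le> \<epsilon> * t"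
        using \<epsilon> by (simp add: distrib_left[symmetric] del: of_nat_Suc)
      moreover have "t / \<delta> * a \<delta> - a t = (t / \<delta> - real (Suc n)) * a \<delta>
          - (a t - a (real (Suc n) * \<delta>)) - (a (real (Suc n) * \<delta>) - real (Suc n) * a \<delta>)"
        by (simp add: algebra_simps)
      ultimately have "\<bar>t / \<delta> * a \<delta> - a t\<bar> \<le> \<epsilon> * t + 2 * B * \<delta>"
        using rem frac iter[OF up] by linarith
      also have "\<dots> \<le> \<epsilon> * t + \<epsilon> * t"
      proof -
        have "2 * B * \<delta> \<le> (2 * B + 1) * \<delta>" using \<delta> by (simp add: algebra_simps)
        also have "\<dots> \<le> \<epsilon> * t" using dt(2) B0 by (simp add: field_simps)
        finally show ?thesis by simp
      qed
      finally have "\<bar>t / \<delta> * a \<delta> - a t\<bar> \<le> t * (2 * \<epsilon>)" by (simp add: algebra_simps)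
      moreover have "t / \<delta> * a \<delta> - a t = t * (a \<delta> / \<delta> - a t / t)" using t by (simp add: field_simps)
      ultimately show ?thesis using t by (simp add: abs_mult)
    qed
    then show ?thesis using t d by blast
  qed
  have "Cauchy (\<lambda>n. a (1 / real (Suc n)) / (1 / real (Suc n)))" (is "Cauchy ?F")
  proof (rule metric_CauchyI)
    fix e :: real assume e: "0 < e"
    obtain t d where td: "0 < d" "\<And>\<delta>. 0 < \<delta> \<Longrightarrow> \<delta> < d \<Longrightarrow> \<bar>a \<delta> / \<delta> - a t / t\<bar> \<le> 2 * (e / 5)"
      using near[of "e / 5"] e by auto
    obtain N where N: "1 / real (Suc N) < d" using reals_Archimedean[OF td(1)] by (auto simp: inverse_eq_divide)
    have "\<bar>?F n - a t / t\<bar> \<le> 2 * (e / 5)" if "N \<le> n" for n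
    proof -
      have "1 / real (Suc n) \<le> 1 / real (Suc N)" using that by (simp add: field_simps)
      then show ?thesis using N by (intro td(2)) auto
    qed
    note F = this
    have "dist (?F m) (?F n) < e" if "N \<le> m" "N \<le> n" for m n
      using F[OF that(1)] F[OF that(2)] e unfolding dist_real_def by linarith
    then show "\<exists>M. \<forall>m\<ge>M. \<forall>n\<ge>M. dist (?F m) (?F n) < e" by blast
  qed
  then obtain l where l: "?F \<longlonglongrightarrow> l" using Cauchy_convergent_iff convergent_def by blast
  have "((\<lambda>\<delta>. a \<delta> / \<delta>) \<longlongrightarrow> l) (at_right 0)"
  proof (rule tendstoI)
    fix e :: real assume e: "0 < e"
    obtain t d where td: "0 < d" "\<And>\<delta>. 0 < \<delta> \<Longrightarrow> \<delta> < d \<Longrightarrow> \<bar>a \<delta> / \<delta> - a t / t\<bar> \<le> 2 * (e / 6)"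
      using near[of "e / 6"] e by auto
    have "\<forall>\<^sub>F n in sequentially. dist (?F n) l < e / 6" using l e by (intro tendstoD) auto
    moreover have "\<forall>\<^sub>F n in sequentially. 1 / real (Suc n) < d"
      using LIMSEQ_inverse_real_of_nat td(1) by (intro order_tendstoD(2)[of _ 0]) (auto simp: inverse_eq_divide)
    ultimately have "\<forall>\<^sub>F n in sequentially. \<bar>l - a t / t\<bar> \<le> e / 2"
    proof eventually_elim
      case (elim n)
      have "\<bar>?F n - a t / t\<bar> \<le> 2 * (e / 6)" using elim(2) by (intro td(2)) auto
      then show ?case using elim(1) unfolding dist_real_def by linarith
    qed
    then have lt: "\<bar>l - a t / t\<bar> \<le> e / 2" by (simp add: eventually_const_iff)
    have "\<forall>\<^sub>F \<delta> in at_right 0. 0 < \<delta> \<and> \<delta> < d"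
      using eventually_at_right_real[OF td(1)] by simp
    then show "\<forall>\<^sub>F \<delta> in at_right 0. dist (a \<delta> / \<delta>) l < e"
    proof eventually_elim
      case (elim \<delta>)
      then show ?case using td(2)[of \<delta>] lt e unfolding dist_real_def by linarith
    qed
  qed
  then show ?thesis by blast
qed

section \<open>A Lipschitz function that is quadratic at zero\<close>

text \<open>
  This is \<open>sqrt (1 + |y|\<^sup>2) - 1\<close>, comparable with \<open>min |y| |y|\<^sup>2\<close>. It replaces the second moment,
  whose expectation is not governed by independence tested on Lipschitz functions.
\<close>

definition soft_norm :: "'a::real_normed_vector \<Rightarrow> real" where
  "soft_norm y = norm (1::real, y) - 1"

lemma soft_norm_nonneg: "0 \<le> soft_norm y"
  using norm_fst_le[of "1::real" y] by (simp add: soft_norm_def)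

lemma soft_norm_lipschitz: "\<bar>soft_norm x - soft_norm y\<bar> \<le> norm (x - y)"
  using norm_triangle_ineq3[of "(1::real, x)" "(1, y)"] by (simp add: soft_norm_def norm_Pair)

lemma soft_norm_le_norm: "soft_norm y \<le> norm y"
  using norm_Pair_le[of "1::real" y] by (simp add: soft_norm_def)

lemma min_norm_power2_le_soft_norm: "min (norm y) ((norm y)\<^sup>2) \<le> 3 * soft_norm y"
proof -
  define r S where "r = norm y" and "S = norm (1::real, y)"
  have r: "0 \<le> r" by (simp add: r_def)
  have S2: "S\<^sup>2 = 1 + r\<^sup>2" by (simp add: S_def r_def norm_Pair)
  have S1: "1 \<le> S" using norm_fst_le[of "1::real" y] by (simp add: S_def)
  have Sr: "S \<le> 1 + r" using norm_Pair_le[of "1::real" y] by (simp add: S_def r_def)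
  have q: "r\<^sup>2 \<le> (S - 1) * (2 + r)"
  proof -
    have "r\<^sup>2 = (S - 1) * (S + 1)" using S2 by (simp add: power2_eq_square algebra_simps)
    also have "\<dots> \<le> (S - 1) * (2 + r)" using S1 Sr by (intro mult_left_mono) auto
    finally show ?thesis .
  qed
  have "min r (r\<^sup>2) \<le> 3 * (S - 1)"
  proof (cases "r \<le> 1")
    case True
    have "(S - 1) * (2 + r) \<le> (S - 1) * 3" using S1 True by (intro mult_left_mono) auto
    then show ?thesis using q by linarith
  next
    case False
    have "(S - 1) * (2 + r) \<le> (S - 1) * (3 * r)" using S1 False by (intro mult_left_mono) auto
    then have "r * r \<le> r * (3 * (S - 1))" using q by (simp add: power2_eq_square algebra_simps)
    then have "r \<le> 3 * (S - 1)" using False by (simp add: mult_le_cancel_left)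
    then show ?thesis by linarith
  qed
  then show ?thesis by (simp add: r_def S_def soft_norm_def)
qed

text \<open>
  With \<open>a\<close>, \<open>b\<close>, \<open>S\<close> the values of \<open>sqrt (1 + |\<cdot>|\<^sup>2)\<close> at \<open>x\<close>, \<open>x + y\<close>, \<open>y\<close>, the convexity gap at \<open>x\<close>
  is \<open>b - a - x \<bullet> y / a\<close>. Since \<open>(a b)\<^sup>2 - (a\<^sup>2 + x \<bullet> y)\<^sup>2 = a\<^sup>2 |y|\<^sup>2 - (x \<bullet> y)\<^sup>2 \<ge> |y|\<^sup>2\<close>, dividing by the
  conjugate bounds it below by \<open>(S - 1) / (2 a\<^sup>3)\<close>, and \<open>1 / a\<^sup>3 \<ge> 1 - 3 |x|\<close>. A weight that is
  affine in \<open>|x|\<close> can be integrated using only the first absolute moment.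
\<close>

lemma soft_norm_uniformly_convex:
  fixes x y :: "'a::real_inner"
  shows "soft_norm x + (x /\<^sub>R norm (1::real, x)) \<bullet> y + (1 - 3 * norm x) / 2 * soft_norm y \<le> soft_norm (x + y)"
proof -
  define a b S r v where "a = norm (1::real, x)" and "b = norm (1::real, x + y)"
    and "S = norm (1::real, y)" and "r = norm x" and "v = x \<bullet> y"
  have a2: "a\<^sup>2 = 1 + r\<^sup>2" by (simp add: a_def r_def norm_Pair)
  have S2: "S\<^sup>2 = 1 + (norm y)\<^sup>2" by (simp add: S_def norm_Pair)
  have b2: "b\<^sup>2 = a\<^sup>2 + 2 * v + (norm y)\<^sup>2"
  proof -
    have "b\<^sup>2 = 1 + (norm (x + y))\<^sup>2" by (simp add: b_def norm_Pair)
    then show ?thesis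
      unfolding a2 by (simp add: r_def v_def power2_norm_eq_inner inner_add_left inner_add_right inner_commute)
  qed
  have ge1: "1 \<le> a" "1 \<le> b" "1 \<le> S"
    using norm_fst_le[of "1::real" x] norm_fst_le[of "1::real" "x + y"] norm_fst_le[of "1::real" y]
    by (simp_all add: a_def b_def S_def)
  have ar: "a \<le> 1 + r" using norm_Pair_le[of "1::real" x] by (simp add: a_def r_def)
  have r: "0 \<le> r" by (simp add: r_def)
  have yS: "norm y \<le> S" using norm_snd_le[of y "1::real"] by (simp add: S_def)
  have "v\<^sup>2 \<le> r\<^sup>2 * (norm y)\<^sup>2"
    using Cauchy_Schwarz_ineq[of x y] by (simp add: v_def r_def power2_norm_eq_inner)
  moreover have "(a * b)\<^sup>2 - (a\<^sup>2 + v)\<^sup>2 = a\<^sup>2 * (norm y)\<^sup>2 - v\<^sup>2"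
    unfolding power_mult_distrib b2 by (simp add: power2_eq_square algebra_simps)
  moreover have "a\<^sup>2 * (norm y)\<^sup>2 = (norm y)\<^sup>2 + r\<^sup>2 * (norm y)\<^sup>2"
    unfolding a2 by (simp add: distrib_right)
  ultimately have sq: "(norm y)\<^sup>2 \<le> (a * b)\<^sup>2 - (a\<^sup>2 + v)\<^sup>2" by linarith
  moreover have "0 \<le> (norm y)\<^sup>2" by simp
  ultimately have "(a\<^sup>2 + v)\<^sup>2 \<le> (a * b)\<^sup>2" by linarith
  moreover have "0 \<le> a * b" using ge1 by simp
  ultimately have le: "a\<^sup>2 + v \<le> a * b" by (rule power2_le_imp_le)
  define N where "N = a * b - a\<^sup>2 - v"
  have N: "0 \<le> N" using le by (simp add: N_def)
  have b_le: "b \<le> a * (1 + S)"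
  proof -
    have "b \<le> a + norm y"
      using norm_triangle_ineq[of "(1::real, x)" "(0, y)"] by (simp add: a_def b_def norm_Pair)
    also have "\<dots> \<le> a + a * S" using yS ge1 mult_mono[of 1 a "norm y" S] by simp
    finally show ?thesis by (simp add: algebra_simps)
  qed
  have "(S - 1) * (S + 1) = (norm y)\<^sup>2" using S2 by (simp add: power2_eq_square algebra_simps)
  also have "\<dots> \<le> N * (a * b + a\<^sup>2 + v)" using sq by (simp add: N_def power2_eq_square algebra_simps)
  also have "\<dots> \<le> N * (2 * (a * b))" using le N by (intro mult_left_mono) auto
  also have "\<dots> \<le> N * (2 * (a * (a * (1 + S))))" using b_le ge1 N by (intro mult_left_mono) auto
  finally have "(S + 1) * (S - 1) \<le> (S + 1) * (2 * a\<^sup>2 * N)"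
    by (simp add: power2_eq_square algebra_simps)
  then have SN: "S - 1 \<le> 2 * a\<^sup>2 * N" using ge1 by (simp add: mult_le_cancel_left)
  have a3: "(1 - 3 * r) * a ^ 3 \<le> 1"
  proof (cases "1 - 3 * r \<le> 0")
    case True
    then have "(1 - 3 * r) * a ^ 3 \<le> 0" using ge1 by (intro mult_nonpos_nonneg) auto
    then show ?thesis by linarith
  next
    case False
    have "(1 - 3 * r) * a ^ 3 \<le> (1 - 3 * r) * (1 + r) ^ 3"
      using False ar ge1 by (intro mult_left_mono power_mono) auto
    also have "\<dots> = 1 - 6 * r ^ 2 - 8 * r ^ 3 - 3 * r ^ 4" by algebra
    also have "\<dots> \<le> 1"
      using zero_le_power[OF r, of 2] zero_le_power[OF r, of 3] zero_le_power[OF r, of 4] by linarith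
    finally show ?thesis .
  qed
  have "(1 - 3 * r) * a ^ 3 * (S - 1) \<le> 1 * (S - 1)" using a3 ge1 by (intro mult_right_mono) auto
  then have "a\<^sup>2 * ((1 - 3 * r) * a * (S - 1)) \<le> a\<^sup>2 * (2 * N)"
    using SN by (simp add: power2_eq_square power3_eq_cube algebra_simps)
  then have "(1 - 3 * r) * a * (S - 1) \<le> 2 * N" using ge1 by (simp add: mult_le_cancel_left)
  then have "(1 - 3 * r) / 2 * (S - 1) \<le> N / a" using ge1 by (simp add: field_simps)
  also have "N / a = b - a - v / a" using ge1 by (simp add: N_def field_simps power2_eq_square)
  finally have "(a - 1) + v / a + (1 - 3 * r) / 2 * (S - 1) \<le> b - 1" by simp
  moreover have "soft_norm x = a - 1" "soft_norm y = S - 1" "soft_norm (x + y) = b - 1"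
    by (simp_all only: soft_norm_def a_def S_def b_def)
  moreover have "(x /\<^sub>R norm (1::real, x)) \<bullet> y = v / a"
    unfolding a_def[symmetric] v_def by (simp add: divide_inverse)
  ultimately show ?thesis unfolding r_def by simp
qed

section \<open>Real-valued Lipschitz functions\<close>

definition lipschitz_fun :: "('a::real_normed_vector \<Rightarrow> real) \<Rightarrow> bool" where
  "lipschitz_fun f \<longleftrightarrow> (\<exists>L. L-lipschitz_on UNIV f)"

lemma lipschitz_funI: "(\<And>x y. \<bar>f x - f y\<bar> \<le> L * norm (x - y)) \<Longrightarrow> lipschitz_fun f"
proof -
  assume *: "\<And>x y. \<bar>f x - f y\<bar> \<le> L * norm (x - y)"
  have "\<bar>f x - f y\<bar> \<le> \<bar>L\<bar> * norm (x - y)" for x y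
    using *[of x y] mult_right_mono[OF abs_ge_self norm_ge_zero, of L "x - y"] by linarith
  then show ?thesis
    unfolding lipschitz_fun_def by (intro exI[of _ "\<bar>L\<bar>"] lipschitz_onI) (auto simp: dist_norm)
qed

lemma lipschitz_funE:
  assumes "lipschitz_fun f"
  obtains L where "0 \<le> L" "\<And>x y. \<bar>f x - f y\<bar> \<le> L * norm (x - y)"
  using assms lipschitz_on_nonneg lipschitz_on_normD unfolding lipschitz_fun_def
  by (metis UNIV_I real_norm_def)

lemma lipschitz_fun_const: "lipschitz_fun (\<lambda>_. c)"
  unfolding lipschitz_fun_def using lipschitz_on_constant by blast

lemma lipschitz_fun_add: "lipschitz_fun f \<Longrightarrow> lipschitz_fun g \<Longrightarrow> lipschitz_fun (\<lambda>x. f x + g x)"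
  unfolding lipschitz_fun_def using lipschitz_on_add by blast

lemma lipschitz_fun_cmult: "lipschitz_fun f \<Longrightarrow> lipschitz_fun (\<lambda>x. c * f x)"
  unfolding lipschitz_fun_def using lipschitz_on_cmult_real by blast

lemma lipschitz_fun_uminus: "lipschitz_fun f \<Longrightarrow> lipschitz_fun (\<lambda>x. - f x)"
  using lipschitz_fun_cmult[of f "-1"] by simp

lemma lipschitz_fun_diff: "lipschitz_fun f \<Longrightarrow> lipschitz_fun g \<Longrightarrow> lipschitz_fun (\<lambda>x. f x - g x)"
  using lipschitz_fun_add[OF _ lipschitz_fun_uminus, of f g] by simp

lemma lipschitz_fun_translate: "lipschitz_fun f \<Longrightarrow> lipschitz_fun (\<lambda>y. f (x + y))"
proof (elim lipschitz_funE)
  fix L assume "\<And>x y. \<bar>f x - f y\<bar> \<le> L * norm (x - y)"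
  from this[of "x + _" "x + _"] show ?thesis by (intro lipschitz_funI[of _ L]) simp
qed

lemma lipschitz_fun_norm: "lipschitz_fun norm"
  by (rule lipschitz_funI[of _ 1]) (simp add: norm_triangle_ineq3)

lemma lipschitz_fun_soft_norm: "lipschitz_fun soft_norm"
  by (rule lipschitz_funI[of _ 1]) (simp add: soft_norm_lipschitz)

lemma lipschitz_fun_inner: "lipschitz_fun (\<lambda>y. p \<bullet> y)"
  by (rule lipschitz_funI[of _ "norm p"]) (simp add: inner_diff_right[symmetric] Cauchy_Schwarz_ineq2)

lemmas lipschitz_fun_intros =
  lipschitz_fun_const lipschitz_fun_add lipschitz_fun_cmult lipschitz_fun_uminus lipschitz_fun_diff
  lipschitz_fun_norm lipschitz_fun_soft_norm lipschitz_fun_inner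

section \<open>Sublinear convolution semigroups and their generator\<close>

text \<open>
  The model is \<open>T t f = E[f(X t)]\<close> for a process with stationary independent increments. In
  \<open>convolution\<close>, the inner functional acts on an increment of length \<open>s\<close> after the value at time \<open>t\<close>
  has been frozen at \<open>x\<close>.
\<close>

locale sublinear_convolution_semigroup =
  fixes T :: "real \<Rightarrow> ('a::euclidean_space \<Rightarrow> real) \<Rightarrow> real"
  assumes mono: "0 \<le> t \<Longrightarrow> lipschitz_fun f \<Longrightarrow> lipschitz_fun g \<Longrightarrow> (\<And>x. f x \<le> g x) \<Longrightarrow> T t f \<le> T t g"
    and const: "T t (\<lambda>_. c) = c"
    and subadd: "0 \<le> t \<Longrightarrow> lipschitz_fun f \<Longrightarrow> lipschitz_fun g \<Longrightarrow> T t (\<lambda>x. f x + g x) \<le> T t f + T t g"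
    and homogeneous: "0 \<le> t \<Longrightarrow> lipschitz_fun f \<Longrightarrow> 0 \<le> c \<Longrightarrow> T t (\<lambda>x. c * f x) = c * T t f"
    and at_zero: "T 0 f = f 0"
    and convolution: "0 \<le> t \<Longrightarrow> 0 \<le> s \<Longrightarrow> lipschitz_fun f \<Longrightarrow> T (t + s) f = T t (\<lambda>x. T s (\<lambda>y. f (x + y)))"
    and norm_tendsto_0: "((\<lambda>t. T t norm) \<longlongrightarrow> 0) (at_right 0)"
begin

lemma diff_le:
  assumes "0 \<le> t" "lipschitz_fun f" "lipschitz_fun g"
  shows "T t f - T t g \<le> T t (\<lambda>x. f x - g x)"
  using subadd[OF assms(1) lipschitz_fun_diff[OF assms(2,3)] assms(3)] by simp

lemma uminus_le: "0 \<le> t \<Longrightarrow> lipschitz_fun f \<Longrightarrow> - T t f \<le> T t (\<lambda>x. - f x)"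
  using diff_le[OF _ lipschitz_fun_const[of 0], of t f] const by simp

lemma add_const:
  assumes "0 \<le> t" "lipschitz_fun f" shows "T t (\<lambda>x. c + f x) = c + T t f"
proof (rule antisym)
  show "T t (\<lambda>x. c + f x) \<le> c + T t f"
    using subadd[OF assms(1) lipschitz_fun_const assms(2), of c] const by simp
  show "c + T t f \<le> T t (\<lambda>x. c + f x)"
    using subadd[OF assms(1) lipschitz_fun_const, of "\<lambda>x. c + f x" "- c"] const assms
    by (simp add: lipschitz_fun_intros)
qed

text \<open>
  For negative \<open>c\<close> this follows from \<open>- T t g \<le> T t (- g)\<close>. It permits
  lower bounds when the sign of the factor is unknown.
\<close>

lemma cmult_ge:
  assumes "0 \<le> t" "lipschitz_fun f" shows "c * T t f \<le> T t (\<lambda>x. c * f x)"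
proof (cases "0 \<le> c")
  case True then show ?thesis using homogeneous[OF assms] by simp
next
  case False
  then have "- ((- c) * T t f) \<le> T t (\<lambda>x. - ((- c) * f x))"
    using uminus_le[OF assms(1) lipschitz_fun_cmult[OF assms(2)], of "- c"] homogeneous[OF assms, of "- c"]
    by simp
  then show ?thesis by simp
qed

lemma norm_nonneg: "0 \<le> t \<Longrightarrow> 0 \<le> T t norm"
  using mono[OF _ lipschitz_fun_const lipschitz_fun_norm, of t 0] const by simp

lemma le_norm:
  assumes "0 \<le> t" "lipschitz_fun f" "0 \<le> c" "\<And>x. f x \<le> c * norm x"
  shows "T t f \<le> c * T t norm"
  using mono[OF assms(1,2) lipschitz_fun_cmult[OF lipschitz_fun_norm], of c]
    homogeneous[OF assms(1) lipschitz_fun_norm assms(3)] assms(4) by simp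

lemma diff_le_norm:
  assumes "0 \<le> t" "lipschitz_fun f" "lipschitz_fun g" "0 \<le> c" "\<And>x. f x - g x \<le> c * norm x"
  shows "T t f - T t g \<le> c * T t norm"
  using diff_le[OF assms(1-3)] le_norm[OF assms(1) lipschitz_fun_diff[OF assms(2,3)] assms(4)] assms(5)
  by fastforce

lemma abs_le_bound:
  assumes "0 \<le> t" "lipschitz_fun f" "\<And>x. \<bar>f x\<bar> \<le> M"
  shows "\<bar>T t f\<bar> \<le> M"
proof -
  have "T t f \<le> T t (\<lambda>_. M)"
    using assms(3) by (intro mono assms lipschitz_fun_const) (simp add: abs_le_iff)
  moreover have "T t (\<lambda>_. - M) \<le> T t f"
    using assms(3) by (intro mono assms lipschitz_fun_const) (metis abs_le_iff minus_le_iff)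
  ultimately show ?thesis using const by simp
qed

lemma translate_lipschitz:
  assumes "0 \<le> t" "0 \<le> L" "\<And>x y. \<bar>f x - f y\<bar> \<le> L * norm (x - y)"
  shows "\<bar>T t (\<lambda>z. f (x + z)) - T t (\<lambda>z. f (y + z))\<bar> \<le> L * norm (x - y)"
proof -
  have f: "lipschitz_fun f" using assms(3) by (rule lipschitz_funI)
  have *: "T t (\<lambda>z. f (x + z)) \<le> L * norm (x - y) + T t (\<lambda>z. f (y + z))" for x y
  proof -
    have "T t (\<lambda>z. f (x + z)) \<le> T t (\<lambda>z. L * norm (x - y) + f (y + z))"
    proof (intro mono assms lipschitz_fun_intros lipschitz_fun_translate[OF f] f)
      fix z show "f (x + z) \<le> L * norm (x - y) + f (y + z)" using assms(3)[of "x + z" "y + z"] by simp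
    qed
    then show ?thesis using add_const[OF assms(1) lipschitz_fun_translate[OF f]] by simp
  qed
  show ?thesis using *[of x y] *[of y x] by (simp add: norm_minus_commute)
qed

lemma lipschitz_fun_semigroup:
  assumes "0 \<le> t" "lipschitz_fun f" shows "lipschitz_fun (\<lambda>x. T t (\<lambda>y. f (x + y)))"
proof -
  obtain L where "0 \<le> L" "\<And>x y. \<bar>f x - f y\<bar> \<le> L * norm (x - y)" using lipschitz_funE[OF assms(2)] by blast
  from translate_lipschitz[OF assms(1) this] show ?thesis by (rule lipschitz_funI)
qed

lemma time_increment:
  assumes "0 \<le> t" "0 \<le> s" "0 \<le> L" "\<And>x y. \<bar>f x - f y\<bar> \<le> L * norm (x - y)"
  shows "\<bar>T (t + s) f - T t f\<bar> \<le> L * T s norm"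
proof -
  have f: "lipschitz_fun f" using assms(4) by (rule lipschitz_funI)
  have step: "\<bar>T s (\<lambda>y. f (x + y)) - f x\<bar> \<le> L * T s norm" for x
  proof -
    have "T s (\<lambda>y. f (x + y)) - T s (\<lambda>_. f x) \<le> L * T s norm"
    proof (rule diff_le_norm[OF assms(2) lipschitz_fun_translate[OF f] lipschitz_fun_const assms(3)])
      fix y show "f (x + y) - f x \<le> L * norm y" using assms(4)[of "x + y" x] by simp
    qed
    moreover have "T s (\<lambda>_. f x) - T s (\<lambda>y. f (x + y)) \<le> L * T s norm"
    proof (rule diff_le_norm[OF assms(2) lipschitz_fun_const lipschitz_fun_translate[OF f] assms(3)])
      fix y show "f x - f (x + y) \<le> L * norm y" using assms(4)[of "x + y" x] by simp
    qed
    ultimately show ?thesis using const by simp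
  qed
  have lf: "lipschitz_fun (\<lambda>x. T s (\<lambda>y. f (x + y)))" using lipschitz_fun_semigroup[OF assms(2) f] .
  have "T (t + s) f = T t (\<lambda>x. T s (\<lambda>y. f (x + y)))" by (rule convolution[OF assms(1,2) f])
  moreover have "T t (\<lambda>x. T s (\<lambda>y. f (x + y))) \<le> T t (\<lambda>x. L * T s norm + f x)"
  proof (intro mono assms lf lipschitz_fun_intros f)
    fix x show "T s (\<lambda>y. f (x + y)) \<le> L * T s norm + f x" using step[of x] by linarith
  qed
  moreover have "T t (\<lambda>x. - (L * T s norm) + f x) \<le> T t (\<lambda>x. T s (\<lambda>y. f (x + y)))"
  proof (intro mono assms lf lipschitz_fun_intros f)
    fix x show "- (L * T s norm) + f x \<le> T s (\<lambda>y. f (x + y))" using step[of x] by linarith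
  qed
  ultimately show ?thesis
    using add_const[OF assms(1) f, of "L * T s norm"] add_const[OF assms(1) f, of "- (L * T s norm)"]
    by linarith
qed

lemma inner_additive:
  assumes "0 \<le> t" "0 \<le> s"
  shows "T (t + s) (\<lambda>y. p \<bullet> y) = T t (\<lambda>y. p \<bullet> y) + T s (\<lambda>y. p \<bullet> y)"
proof -
  have "T (t + s) (\<lambda>y. p \<bullet> y) = T t (\<lambda>x. T s (\<lambda>y. p \<bullet> x + p \<bullet> y))"
    using convolution[OF assms lipschitz_fun_inner, of p] by (simp add: inner_add_right)
  also have "\<dots> = T t (\<lambda>x. T s (\<lambda>y. p \<bullet> y) + p \<bullet> x)"
    using add_const[OF assms(2) lipschitz_fun_inner] by (simp add: add.commute)
  also have "\<dots> = T s (\<lambda>y. p \<bullet> y) + T t (\<lambda>x. p \<bullet> x)" by (rule add_const[OF assms(1) lipschitz_fun_inner])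
  finally show ?thesis by simp
qed

text \<open>
  With the threshold \<open>1 / 6\<close>, the weight \<open>(1 - 3 |x|) / 2\<close> of \<open>soft_norm_uniformly_convex\<close> averages to
  at least \<open>1 / 4\<close>.
\<close>

lemma ex_small_time: "\<exists>b>0. \<forall>t. 0 < t \<and> t \<le> b \<longrightarrow> T t norm \<le> 1 / 6"
proof -
  have "\<forall>\<^sub>F t in at_right 0. T t norm < 1 / 6" using norm_tendsto_0 by (rule order_tendstoD) simp
  then obtain b where b: "0 < b" "\<And>t. 0 < t \<Longrightarrow> t < b \<Longrightarrow> T t norm < 1 / 6"
    unfolding eventually_at_right_field by auto
  show ?thesis
  proof (intro exI[of _ "b / 2"] conjI allI impI)
    fix t assume "0 < t \<and> t \<le> b / 2"
    then show "T t norm \<le> 1 / 6" using b(2)[of t] b(1) by auto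
  qed (use b in simp)
qed

text \<open>
  On linear functions the semigroup is exactly additive in time, so a
  bound on one interval \<open>(0, b]\<close> forces linear growth.
\<close>

lemma drift_bound:
  assumes b: "\<And>t. 0 < t \<Longrightarrow> t \<le> b \<Longrightarrow> T t norm \<le> 1 / 6" and s: "0 < s" "s \<le> b"
  shows "T s (\<lambda>y. p \<bullet> y) \<le> norm p / (3 * b) * s"
proof -
  have "T s (\<lambda>y. p \<bullet> y) \<le> 2 * (norm p / 6 + 0 * b) / (1 * b) * s"
  proof (rule at_most_linear_growth[where c = "\<lambda>s. T s (\<lambda>y. p \<bullet> y)"])
    fix t assume t: "0 < t" "t \<le> b"
    have "T t (\<lambda>y. p \<bullet> y) \<le> norm p * T t norm"
      using t by (intro le_norm lipschitz_fun_inner) (auto simp: norm_cauchy_schwarz)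
    also have "\<dots> \<le> norm p * (1 / 6)" using b[OF t] by (intro mult_left_mono) auto
    finally show "T t (\<lambda>y. p \<bullet> y) \<le> norm p / 6" by simp
  qed (use s inner_additive in auto)
  then show ?thesis by simp
qed

text \<open>
  Uniform convexity makes \<open>t \<mapsto> T t soft_norm\<close> superadditive up to a factor \<open>1 / 4\<close>: the
  linear term is paid for by \<open>drift_bound\<close>, and the deficit \<open>3 |x|\<close> of the weight is at most one half
  on average. The result is a bound of order \<open>s\<close> on second moments near zero and first moments at infinity.
\<close>

lemma soft_norm_bound:
  assumes b: "\<And>t. 0 < t \<Longrightarrow> t \<le> b \<Longrightarrow> T t norm \<le> 1 / 6" and s: "0 < s" "s \<le> b"
  shows "T s soft_norm \<le> 4 / b * s"
proof -
  define m where "m t = T t soft_norm" for t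
  have m0: "0 \<le> m t" if "0 \<le> t" for t
    using mono[OF that lipschitz_fun_const lipschitz_fun_soft_norm, of 0] const
    by (simp add: m_def soft_norm_nonneg)
  have "m s \<le> 2 * (1 / 6 + 1 / (3 * b) * b) / (1 / 4 * b) * s"
  proof (rule at_most_linear_growth[where c = m])
    fix t assume t: "0 < t" "t \<le> b"
    have "m t \<le> 1 * T t norm" unfolding m_def
      using t by (intro le_norm lipschitz_fun_soft_norm) (auto simp: soft_norm_le_norm)
    then show "m t \<le> 1 / 6" using b[OF t] by simp
  next
    fix t s :: real assume ts: "0 < t" "0 < s" "t + s \<le> b"
    then have ts': "0 \<le> t" "0 \<le> s" "t \<le> b" "s \<le> b" by auto
    define D where "D = 1 / (3 * b) * s"
    have inner: "soft_norm x + (1 / 2 * m s - D - 3 / 2 * m s * norm x) \<le> T s (\<lambda>y. soft_norm (x + y))" for x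
    proof -
      \<comment> \<open>The slope of \<open>soft_norm\<close> at \<open>x\<close>, of norm at most one, and the weight from uniform convexity.\<close>
      define p where "p = x /\<^sub>R norm (1::real, x)"
      define k where "k = (1 - 3 * norm x) / 2"
      have "1 \<le> norm (1::real, x)" using norm_fst_le[of "1::real" x] by simp
      moreover have "norm p = norm x / norm (1::real, x)" by (simp add: p_def divide_inverse)
      ultimately have "norm p \<le> 1" using norm_snd_le[of x "1::real"]
        by (metis divide_le_eq_1_pos less_le_trans zero_less_one)
      have "T s (\<lambda>y. (- p) \<bullet> y) \<le> norm (- p) / (3 * b) * s" by (rule drift_bound[OF b ts(2) ts'(4)])
      also have "\<dots> \<le> D" unfolding D_def using \<open>norm p \<le> 1\<close> ts
        by (intro mult_right_mono divide_right_mono) auto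
      finally have drift: "T s (\<lambda>y. - (p \<bullet> y)) \<le> D" by simp
      have "soft_norm x + (k * m s - D) \<le> soft_norm x + T s (\<lambda>y. k * soft_norm y - - (p \<bullet> y))"
        using diff_le[OF ts'(2) lipschitz_fun_cmult[OF lipschitz_fun_soft_norm, of k]
            lipschitz_fun_uminus[OF lipschitz_fun_inner, of p]]
          cmult_ge[OF ts'(2) lipschitz_fun_soft_norm, of k] drift
        unfolding m_def by linarith
      also have "\<dots> = T s (\<lambda>y. soft_norm x + (k * soft_norm y - - (p \<bullet> y)))"
        by (rule add_const[OF ts'(2), symmetric]) (intro lipschitz_fun_intros)
      also have "\<dots> \<le> T s (\<lambda>y. soft_norm (x + y))"
      proof (rule mono[OF ts'(2)])
        fix y show "soft_norm x + (k * soft_norm y - - (p \<bullet> y)) \<le> soft_norm (x + y)"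
          using soft_norm_uniformly_convex[of x y] unfolding p_def k_def by linarith
      qed (intro lipschitz_fun_intros lipschitz_fun_translate[OF lipschitz_fun_soft_norm])+
      finally show ?thesis unfolding k_def by (simp add: field_simps)
    qed
    define N where "N = 3 / 2 * m s"
    have N: "0 \<le> N" using m0 ts by (simp add: N_def)
    have "m t - N * T t norm \<le> T t (\<lambda>x. soft_norm x - N * norm x)"
      using diff_le[OF ts'(1) lipschitz_fun_soft_norm lipschitz_fun_cmult[OF lipschitz_fun_norm, of N]]
        homogeneous[OF ts'(1) lipschitz_fun_norm N] unfolding m_def by simp
    moreover have "N * T t norm \<le> N * (1 / 6)" using b[of t] ts N by (intro mult_left_mono) auto
    ultimately have "m t + 1 / 4 * m s - D \<le> (1 / 2 * m s - D) + T t (\<lambda>x. soft_norm x - N * norm x)"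
      unfolding N_def by simp
    also have "\<dots> = T t (\<lambda>x. (1 / 2 * m s - D) + (soft_norm x - N * norm x))"
      by (rule add_const[OF ts'(1), symmetric]) (intro lipschitz_fun_intros)
    also have "\<dots> \<le> T t (\<lambda>x. T s (\<lambda>y. soft_norm (x + y)))"
    proof (rule mono[OF ts'(1)])
      fix x show "(1 / 2 * m s - D) + (soft_norm x - N * norm x) \<le> T s (\<lambda>y. soft_norm (x + y))"
        using inner[of x] unfolding N_def by linarith
    qed (intro lipschitz_fun_intros lipschitz_fun_semigroup[OF ts'(2) lipschitz_fun_soft_norm])+
    also have "\<dots> = m (t + s)" unfolding m_def by (rule convolution[OF ts'(1,2) lipschitz_fun_soft_norm, symmetric])
    finally show "m t + 1 / 4 * m s - 1 / (3 * b) * s \<le> m (t + s)" unfolding D_def .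
  qed (use s in auto)
  also have "2 * (1 / 6 + 1 / (3 * b) * b) / (1 / 4 * b) * s = 4 / b * s" using s by simp
  finally show ?thesis unfolding m_def .
qed

text \<open>
  The two preceding bounds add up, and the result is linear in \<open>c\<close>. That linearity
  makes the error in \<open>almost_additive\<close> small when the frozen value is near zero.
\<close>

lemma generator_bound:
  assumes b: "\<And>t. 0 < t \<Longrightarrow> t \<le> b \<Longrightarrow> T t norm \<le> 1 / 6" and s: "0 < s" "s \<le> b"
    and g: "lipschitz_fun g" and p: "norm p \<le> c" and g_le: "\<And>y. g y \<le> p \<bullet> y + c * soft_norm y"
  shows "T s g \<le> 5 / b * c * s"
proof -
  have c: "0 \<le> c" using p norm_ge_zero[of p] by linarith
  have s0: "0 \<le> s" using s by simp
  have "T s g \<le> T s (\<lambda>y. p \<bullet> y + c * soft_norm y)" using g_le by (intro mono s0 g lipschitz_fun_intros)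
  also have "\<dots> \<le> T s (\<lambda>y. p \<bullet> y) + T s (\<lambda>y. c * soft_norm y)" by (intro subadd s0 lipschitz_fun_intros)
  also have "\<dots> \<le> norm p / (3 * b) * s + c * (4 / b * s)"
    using drift_bound[OF b s, of p] mult_left_mono[OF soft_norm_bound[OF b s] c]
      homogeneous[OF s0 lipschitz_fun_soft_norm c] by simp
  also have "norm p / (3 * b) * s \<le> c / b * s"
    using p c s by (intro mult_right_mono frac_le) auto
  finally show ?thesis using s by (simp add: field_simps)
qed

text \<open>
  Freezing the value \<open>x\<close> at time \<open>t\<close>, the mixed difference \<open>f (x + y) - f x - f y\<close> is a function of the
  increment \<open>y\<close> whose slope at zero and remainder are of size \<open>c |x|\<close>. By \<open>generator_bound\<close> its expectation is of
  order \<open>c |x| s\<close>, and \<open>|x|\<close> averages to \<open>T t norm\<close>.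
\<close>

lemma almost_additive:
  assumes b: "\<And>t. 0 < t \<Longrightarrow> t \<le> b \<Longrightarrow> T t norm \<le> 1 / 6" and ts: "0 < t" "0 < s" "s \<le> b"
    and f: "lipschitz_fun f" and c: "0 \<le> c"
    and w: "\<And>x. norm (w x) \<le> c * norm x"
    and second: "\<And>x y. \<bar>f (x + y) - f x - f y - w x \<bullet> y\<bar> \<le> c * norm x * soft_norm y"
  shows "\<bar>T (t + s) f - T t f - T s f\<bar> \<le> 5 / b * c * s * T t norm"
proof -
  have t0: "0 \<le> t" and s0: "0 \<le> s" using ts by auto
  define k where "k = 5 / b * c * s"
  have k: "0 \<le> k" using c ts by (simp add: k_def)
  define v where "v x = T s (\<lambda>y. f (x + y))" for x
  have v: "lipschitz_fun v" unfolding v_def by (rule lipschitz_fun_semigroup[OF s0 f])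
  have up: "v x - f x - T s f \<le> k * norm x" for x
  proof -
    have "v x - (f x + T s f) = T s (\<lambda>y. f (x + y)) - T s (\<lambda>y. f x + f y)"
      using add_const[OF s0 f] by (simp add: v_def)
    also have "\<dots> \<le> T s (\<lambda>y. f (x + y) - (f x + f y))"
      by (intro diff_le s0 lipschitz_fun_translate[OF f] lipschitz_fun_intros f)
    also have "\<dots> \<le> 5 / b * (c * norm x) * s"
    proof (rule generator_bound[OF b ts(2,3) _ w])
      fix y show "f (x + y) - (f x + f y) \<le> w x \<bullet> y + c * norm x * soft_norm y"
        using second[of x y] by linarith
    qed (auto intro!: lipschitz_fun_translate[OF f] lipschitz_fun_intros f)
    finally show ?thesis by (simp add: k_def algebra_simps)
  qed
  have low: "f x + T s f - v x \<le> k * norm x" for x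
  proof -
    have "(f x + T s f) - v x = T s (\<lambda>y. f x + f y) - T s (\<lambda>y. f (x + y))"
      using add_const[OF s0 f] by (simp add: v_def)
    also have "\<dots> \<le> T s (\<lambda>y. (f x + f y) - f (x + y))"
      by (intro diff_le s0 lipschitz_fun_translate[OF f] lipschitz_fun_intros f)
    also have "\<dots> \<le> 5 / b * (c * norm x) * s"
    proof (rule generator_bound[OF b ts(2,3), where p = "- w x"])
      fix y show "(f x + f y) - f (x + y) \<le> - w x \<bullet> y + c * norm x * soft_norm y"
        using second[of x y] by (simp add: abs_le_iff)
    qed (auto intro!: lipschitz_fun_translate[OF f] lipschitz_fun_intros f w)
    finally show ?thesis by (simp add: k_def algebra_simps)
  qed
  have Tv: "T (t + s) f = T t v" unfolding v_def by (rule convolution[OF t0 s0 f])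
  have fs: "T t (\<lambda>x. T s f + f x) = T s f + T t f" by (rule add_const[OF t0 f])
  have "T t v - T t (\<lambda>x. T s f + f x) \<le> k * T t norm"
    using up by (intro diff_le_norm t0 v k lipschitz_fun_intros f) (simp add: algebra_simps)
  moreover have "T t (\<lambda>x. T s f + f x) - T t v \<le> k * T t norm"
    using low by (intro diff_le_norm t0 v k lipschitz_fun_intros f) (simp add: algebra_simps)
  ultimately show ?thesis unfolding Tv fs k_def by linarith
qed

theorem generator_exists:
  assumes f: "lipschitz_fun f" "f 0 = 0" and c: "0 \<le> c"
    and w: "\<And>x. norm (w x) \<le> c * norm x"
    and second: "\<And>x y. \<bar>f (x + y) - f x - f y - w x \<bullet> y\<bar> \<le> c * norm x * soft_norm y"
  shows "\<exists>l. ((\<lambda>\<delta>. T \<delta> f / \<delta>) \<longlongrightarrow> l) (at_right 0)"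
proof -
  obtain b where b: "0 < b" "\<And>t. 0 < t \<Longrightarrow> t \<le> b \<Longrightarrow> T t norm \<le> 1 / 6" using ex_small_time by blast
  obtain L where L: "0 \<le> L" "\<And>x y. \<bar>f x - f y\<bar> \<le> L * norm (x - y)" using lipschitz_funE[OF f(1)] by blast
  show ?thesis
  proof (rule almost_additive_has_right_derivative[OF _ b(1)])
    fix \<epsilon> :: real assume \<epsilon>: "0 < \<epsilon>"
    have "\<forall>\<^sub>F t in at_right 0. T t norm < \<epsilon> / (5 / b * c + 1)"
    proof (rule order_tendstoD(2)[OF norm_tendsto_0])
      have "0 \<le> 5 / b * c" using b(1) c by simp
      then show "0 < \<epsilon> / (5 / b * c + 1)" using \<epsilon> by (intro divide_pos_pos) auto
    qed
    then obtain d where d: "0 < d" "\<And>t. 0 < t \<Longrightarrow> t < d \<Longrightarrow> T t norm < \<epsilon> / (5 / b * c + 1)"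
      unfolding eventually_at_right_field by auto
    have "\<bar>T (t + s) f - T t f - T s f\<bar> \<le> \<epsilon> * s" if ts: "0 < t" "0 < s" "t + s \<le> min (d / 2) b" for t s
    proof -
      define k where "k = 5 / b * c"
      have k: "0 \<le> k" using b c by (simp add: k_def)
      have "T t norm \<le> \<epsilon> / (k + 1)" unfolding k_def using d(2)[of t] ts d(1) by auto
      then have "k * T t norm \<le> k * (\<epsilon> / (k + 1))" using k by (rule mult_left_mono)
      also have "\<dots> = (k) / (k + 1) * \<epsilon>" by simp
      also have "\<dots> \<le> 1 * \<epsilon>" using k \<epsilon> by (intro mult_right_mono pos_divide_le_eq[THEN iffD2]) auto
      finally have "k * T t norm * s \<le> 1 * \<epsilon> * s" using ts by (intro mult_right_mono) auto
      moreover have "\<bar>T (t + s) f - T t f - T s f\<bar> \<le> 5 / b * c * s * T t norm"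
        using ts by (intro almost_additive[OF b(2) _ _ _ f(1) c w second]) auto
      ultimately show ?thesis unfolding k_def by (simp add: algebra_simps)
    qed
    then show "\<exists>\<tau>>0. \<forall>t s. 0 < t \<and> 0 < s \<and> t + s \<le> \<tau> \<longrightarrow> \<bar>T (t + s) f - T t f - T s f\<bar> \<le> \<epsilon> * s"
      using d(1) b(1) by (intro exI[of _ "min (d / 2) b"]) auto
  next
    fix t assume t: "0 < t" "t \<le> b"
    have "\<bar>T (0 + t) f - T 0 f\<bar> \<le> L * T t norm" using t by (intro time_increment L) auto
    also have "\<dots> \<le> L * (1 / 6)" using b(2)[OF t] L by (intro mult_left_mono) auto
    finally show "\<bar>T t f\<bar> \<le> L / 6" using f(2) by (simp add: at_zero)
  qed
qed

end

section \<open>Expansions of test functions\<close>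

lemma gradient_bound:
  fixes F :: "'a::real_inner \<Rightarrow> real"
  assumes "convex S" "\<And>x. x \<in> S \<Longrightarrow> GDERIV F x :> DF x" "\<And>x. x \<in> S \<Longrightarrow> norm (DF x) \<le> B" "x \<in> S" "y \<in> S"
  shows "\<bar>F x - F y\<bar> \<le> B * norm (x - y)"
proof -
  have "norm (F x - F y) \<le> B * norm (x - y)"
  proof (rule differentiable_bound[OF assms(1) _ _ assms(4,5)])
    fix z assume z: "z \<in> S"
    show "(F has_derivative (\<lambda>h. h \<bullet> DF z)) (at z within S)"
      using assms(2)[OF z] unfolding gderiv_def by (rule has_derivative_at_withinI)
    show "onorm (\<lambda>h. h \<bullet> DF z) \<le> B"
    proof (rule onorm_bound)
      show "0 \<le> B" using assms(3)[OF z] norm_ge_zero[of "DF z"] by linarith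
      fix h show "norm (h \<bullet> DF z) \<le> B * norm h"
        using Cauchy_Schwarz_ineq2[of h "DF z"] mult_left_mono[OF assms(3)[OF z] norm_ge_zero[of h]]
        by (simp add: mult.commute)
    qed
  qed
  then show ?thesis by simp
qed

lemma GDERIV_translate:
  assumes "GDERIV F (a + x) :> D" shows "GDERIV (\<lambda>x. F (a + x)) x :> D"
proof -
  have "((\<lambda>x. a + x) has_derivative (\<lambda>h. h)) (at x)" by (auto intro!: derivative_eq_intros)
  from has_derivative_compose[OF this, of F "\<lambda>h. h \<bullet> D"] assms show ?thesis
    unfolding gderiv_def by simp
qed

text \<open>
  For fixed \<open>y\<close>, the function \<open>F (y + w) - F w\<close> of \<open>w\<close> has a gradient of norm at most \<open>K |y|\<close>.
\<close>

lemma second_difference_bound: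
  fixes F :: "'a::real_inner \<Rightarrow> real"
  assumes F: "\<And>x. GDERIV F x :> DF x" and DF: "\<And>x y. norm (DF x - DF y) \<le> K * norm (x - y)"
  shows "\<bar>F (z + x + y) - F (z + x) - F (z + y) + F z\<bar> \<le> K * norm x * norm y"
proof -
  have "\<bar>(F (y + (z + x)) - F (z + x)) - (F (y + z) - F z)\<bar> \<le> K * norm y * norm ((z + x) - z)"
  proof (rule gradient_bound[where S = UNIV and F = "\<lambda>w. F (y + w) - F w"])
    fix w
    show "GDERIV (\<lambda>w. F (y + w) - F w) w :> DF (y + w) - DF w"
      by (intro GDERIV_diff GDERIV_translate F)
    show "norm (DF (y + w) - DF w) \<le> K * norm y" using DF[of "y + w" w] by simp
  qed auto
  then show ?thesis by (simp add: algebra_simps)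
qed

text \<open>
  As a function of \<open>y\<close>, the remainder has the gradient
  \<open>DF (z + x + y) - DF (z + y) - DF (z + x) + DF z\<close>, which is at most \<open>2 K |x|\<close> because \<open>DF\<close> is Lipschitz
  and at most \<open>K |x| |y|\<close> by \<open>DF2\<close>. The first bound serves large \<open>y\<close>, the second small \<open>y\<close>.
\<close>

lemma second_difference_expansion:
  fixes F :: "'a::euclidean_space \<Rightarrow> real"
  assumes F: "\<And>x. GDERIV F x :> DF x" and K: "0 \<le> K"
    and DF: "\<And>x y. norm (DF x - DF y) \<le> K * norm (x - y)"
    and DF2: "\<And>x y. norm (DF (z + x + y) - DF (z + x) - DF (z + y) + DF z) \<le> K * norm x * norm y"
  shows "\<bar>F (z + x + y) - F (z + x) - F (z + y) + F z - (DF (z + x) - DF z) \<bullet> y\<bar>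
          \<le> 6 * K * norm x * soft_norm y"
proof -
  define p where "p = DF (z + x) - DF z"
  define R where "R y = F (z + x + y) - F (z + y) - p \<bullet> y" for y
  define DR where "DR y = DF (z + x + y) - DF (z + y) - p" for y
  have R: "GDERIV R y :> DR y" for y
  proof -
    have "GDERIV (\<lambda>y. p \<bullet> y) y :> p"
      unfolding gderiv_def by (auto intro!: derivative_eq_intros simp: inner_commute)
    then show ?thesis unfolding R_def DR_def by (intro GDERIV_diff GDERIV_translate F)
  qed
  have bound: "\<bar>R y - R 0\<bar> \<le> B * norm y" if "\<And>y'. norm y' \<le> norm y \<Longrightarrow> norm (DR y') \<le> B" for B and y :: 'a
    using gradient_bound[of "cball 0 (norm y)" R DR B y 0] R that by (auto simp: dist_norm)
  have "\<bar>R y - R 0\<bar> \<le> 2 * K * norm x * norm y"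
  proof (rule bound)
    fix y'
    have "norm (DR y') \<le> norm (DF (z + x + y') - DF (z + y')) + norm p"
      unfolding DR_def by (rule norm_triangle_ineq4)
    also have "\<dots> \<le> K * norm x + K * norm x"
      using DF[of "z + x + y'" "z + y'"] DF[of "z + x" z] by (simp add: p_def)
    finally show "norm (DR y') \<le> 2 * K * norm x" by simp
  qed
  moreover have "\<bar>R y - R 0\<bar> \<le> 2 * K * norm x * (norm y)\<^sup>2"
  proof -
    have "\<bar>R y - R 0\<bar> \<le> K * norm x * norm y * norm y"
    proof (rule bound)
      fix y' :: 'a assume "norm y' \<le> norm y"
      then have "K * norm x * norm y' \<le> K * norm x * norm y" using K by (intro mult_left_mono) auto
      moreover have "DR y' = DF (z + x + y') - DF (z + x) - DF (z + y') + DF z"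
        by (simp add: DR_def p_def)
      ultimately show "norm (DR y') \<le> K * norm x * norm y" using DF2[of x y'] by simp
    qed
    also have "\<dots> \<le> 2 * K * norm x * (norm y)\<^sup>2" using K by (simp add: power2_eq_square)
    finally show ?thesis .
  qed
  ultimately have "\<bar>R y - R 0\<bar> \<le> 2 * K * norm x * min (norm y) ((norm y)\<^sup>2)" by (simp add: min_def)
  also have "\<dots> \<le> 2 * K * norm x * (3 * soft_norm y)"
    using K by (intro mult_left_mono min_norm_power2_le_soft_norm) auto
  finally show ?thesis by (simp add: R_def p_def algebra_simps)
qed

lemma bdd_contE:
  assumes "bdd_cont \<psi>"
  obtains M where "0 \<le> M" "\<And>t x. 0 < t \<Longrightarrow> \<bar>\<psi> t x\<bar> \<le> M"
proof -
  obtain M where "\<forall>z \<in> case_prod \<psi> ` ({0<..} \<times> UNIV). norm z \<le> M"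
    using assms unfolding bdd_cont_def bounded_iff by blast
  then have M: "\<bar>\<psi> t x\<bar> \<le> M" if "0 < t" for t x using that by fastforce
  have "0 \<le> M" using M[of 1 0] by linarith
  with M that show thesis by blast
qed

lemma Cb_space_imp_bdd_cont: "Cb_space k \<psi> \<Longrightarrow> bdd_cont \<psi>"
  by (cases k) auto

lemma norm_le_sum_components:
  fixes v :: "'a::euclidean_space"
  assumes "\<And>b. b \<in> Basis \<Longrightarrow> \<bar>v \<bullet> b\<bar> \<le> M b * k"
  shows "norm v \<le> (\<Sum>b\<in>(Basis::'a set). M b) * k"
proof -
  have "norm v \<le> (\<Sum>b\<in>Basis. \<bar>v \<bullet> b\<bar>)" by (rule norm_le_l1)
  also have "\<dots> \<le> (\<Sum>b\<in>(Basis::'a set). M b * k)" using assms by (rule sum_mono)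
  finally show ?thesis by (simp add: sum_distrib_right)
qed

lemma Cb_space_Suc_lipschitz:
  fixes \<psi> :: "real \<Rightarrow> 'a::euclidean_space \<Rightarrow> real"
  assumes "Cb_space (Suc k) \<psi>"
  shows "\<exists>L\<ge>0. \<forall>t>0. \<forall>x y. \<bar>\<psi> t x - \<psi> t y\<bar> \<le> L * norm (x - y)"
proof -
  obtain D where D: "\<And>t x. 0 < t \<Longrightarrow> GDERIV (\<psi> t) x :> D t x"
    and Db: "\<And>b. b \<in> Basis \<Longrightarrow> Cb_space k (\<lambda>t x. D t x \<bullet> b)"
    using assms by auto
  have "\<forall>b\<in>Basis. \<exists>M\<ge>0. \<forall>t>0. \<forall>x. \<bar>D t x \<bullet> b\<bar> \<le> M"
    using Db Cb_space_imp_bdd_cont bdd_contE by (metis (no_types, lifting))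
  then obtain M where M: "\<And>b. b \<in> Basis \<Longrightarrow> 0 \<le> M b" "\<And>b t x. b \<in> Basis \<Longrightarrow> 0 < t \<Longrightarrow> \<bar>D t x \<bullet> b\<bar> \<le> M b"
    by metis
  have "norm (D t x) \<le> (\<Sum>b\<in>Basis. M b)" if "0 < t" for t x
    using norm_le_sum_components[of "D t x" M 1] M(2)[OF _ that] by simp
  then have "\<forall>t>0. \<forall>x y. \<bar>\<psi> t x - \<psi> t y\<bar> \<le> (\<Sum>b\<in>Basis. M b) * norm (x - y)"
    using D by (auto intro!: gradient_bound[of UNIV])
  moreover have "0 \<le> (\<Sum>b\<in>Basis. M b)" using M(1) by (rule sum_nonneg)
  ultimately show ?thesis by blast
qed

lemma Cb_space_Suc_Suc_gradient_lipschitz: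
  fixes \<psi> :: "real \<Rightarrow> 'a::euclidean_space \<Rightarrow> real"
  assumes "Cb_space (Suc (Suc k)) \<psi>"
  shows "\<exists>D K. 0 \<le> K \<and> (\<forall>t>0. \<forall>x. GDERIV (\<psi> t) x :> D t x) \<and>
           (\<forall>b\<in>Basis. Cb_space (Suc k) (\<lambda>t x. D t x \<bullet> b)) \<and>
           (\<forall>t>0. \<forall>x y. norm (D t x - D t y) \<le> K * norm (x - y))"
proof -
  obtain D where D: "\<forall>t>0. \<forall>x. GDERIV (\<psi> t) x :> D t x"
    and Db: "\<forall>b\<in>Basis. Cb_space (Suc k) (\<lambda>t x. D t x \<bullet> b)"
    using assms unfolding Cb_space.simps(2)[of "Suc k"] by blast
  have "\<forall>b\<in>Basis. \<exists>L\<ge>0. \<forall>t>0. \<forall>x y. \<bar>D t x \<bullet> b - D t y \<bullet> b\<bar> \<le> L * norm (x - y)"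
    using Db Cb_space_Suc_lipschitz by blast
  then obtain L where L: "\<And>b. b \<in> Basis \<Longrightarrow> 0 \<le> L b"
    "\<And>b t x y. b \<in> Basis \<Longrightarrow> 0 < t \<Longrightarrow> \<bar>D t x \<bullet> b - D t y \<bullet> b\<bar> \<le> L b * norm (x - y)"
    by metis
  have "norm (D t x - D t y) \<le> (\<Sum>b\<in>Basis. L b) * norm (x - y)" if "0 < t" for t x y
    using L(2)[OF _ that] by (intro norm_le_sum_components) (simp add: inner_diff_left)
  moreover have "0 \<le> (\<Sum>b\<in>Basis. L b)" using L(1) by (rule sum_nonneg)
  ultimately show ?thesis using D Db by blast
qed

text \<open>
  The third derivatives enter only through the second differences of the gradient; applying
  \<open>second_difference_bound\<close> to each component of the gradient supplies them.
\<close>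

lemma Cb_space_3_expansion:
  fixes \<psi> :: "real \<Rightarrow> 'a::euclidean_space \<Rightarrow> real"
  assumes "Cb_space 3 \<psi>" and t: "0 < t"
  shows "\<exists>w c. 0 \<le> c \<and> (\<forall>x. norm (w x) \<le> c * norm x) \<and>
    (\<forall>x y. \<bar>\<psi> t (z + x + y) - \<psi> t (z + x) - \<psi> t (z + y) + \<psi> t z - w x \<bullet> y\<bar> \<le> c * norm x * soft_norm y)"
proof -
  have "Cb_space (Suc (Suc (Suc 0))) \<psi>" using assms(1) by (simp only: numeral_3_eq_3)
  from Cb_space_Suc_Suc_gradient_lipschitz[OF this] obtain D K where K: "0 \<le> K"
    and D: "\<forall>t>0. \<forall>x. GDERIV (\<psi> t) x :> D t x"
    and Db: "\<forall>b\<in>Basis. Cb_space (Suc (Suc 0)) (\<lambda>t x. D t x \<bullet> b)"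
    and D_lip: "\<forall>t>0. \<forall>x y. norm (D t x - D t y) \<le> K * norm (x - y)"
    by blast
  have "\<exists>L\<ge>0. \<forall>x y. \<bar>(D t (z + x + y) - D t (z + x) - D t (z + y) + D t z) \<bullet> b\<bar> \<le> L * (norm x * norm y)"
    if b: "b \<in> Basis" for b
  proof -
    obtain D' L where "0 \<le> L" "\<forall>t>0. \<forall>x. GDERIV (\<lambda>x. D t x \<bullet> b) x :> D' t x"
      "\<forall>t>0. \<forall>x y. norm (D' t x - D' t y) \<le> L * norm (x - y)"
      using Cb_space_Suc_Suc_gradient_lipschitz[OF Db[rule_format, OF b]] by blast
    then show ?thesis
      using second_difference_bound[of "\<lambda>x. D t x \<bullet> b" "D' t" L z] t
      by (auto simp: inner_diff_left inner_add_left mult.assoc)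
  qed
  then obtain L where L: "\<And>b. b \<in> Basis \<Longrightarrow> 0 \<le> L b"
    "\<And>b x y. b \<in> Basis \<Longrightarrow> \<bar>(D t (z + x + y) - D t (z + x) - D t (z + y) + D t z) \<bullet> b\<bar> \<le> L b * (norm x * norm y)"
    by metis
  define M where "M = max K (\<Sum>b\<in>Basis. L b)"
  have M: "0 \<le> M" using K by (simp add: M_def)
  have lip: "norm (D t x - D t y) \<le> M * norm (x - y)" for x y
    by (rule order_trans[OF D_lip[rule_format, OF t] mult_right_mono]) (auto simp: M_def)
  have second: "norm (D t (z + x + y) - D t (z + x) - D t (z + y) + D t z) \<le> M * norm x * norm y" for x y
  proof -
    have "norm (D t (z + x + y) - D t (z + x) - D t (z + y) + D t z) \<le> (\<Sum>b\<in>Basis. L b) * (norm x * norm y)"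
      using L(2) by (rule norm_le_sum_components)
    also have "\<dots> \<le> M * (norm x * norm y)" by (intro mult_right_mono) (auto simp: M_def)
    finally show ?thesis by (simp add: mult.assoc)
  qed
  show ?thesis
  proof (intro exI[of _ "\<lambda>x. D t (z + x) - D t z"] exI[of _ "6 * M"] conjI allI)
    fix x y
    show "norm (D t (z + x) - D t z) \<le> 6 * M * norm x"
      using lip[of "z + x" z] mult_nonneg_nonneg[OF M norm_ge_zero[of x]] by simp
    show "\<bar>\<psi> t (z + x + y) - \<psi> t (z + x) - \<psi> t (z + y) + \<psi> t z - (D t (z + x) - D t z) \<bullet> y\<bar>
        \<le> 6 * M * norm x * soft_norm y"
      using D t M lip second by (intro second_difference_expansion) auto
  qed (use M in simp)
qed

text \<open>
  By the mean value theorem the increment in time is \<open>- \<delta>\<close> times the time derivative at a point near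
  \<open>(t, x + y)\<close>. For small \<open>y\<close> continuity makes this derivative \<open>\<epsilon>\<close>-close to its value at \<open>(t, x)\<close>;
  for large \<open>y\<close> its boundedness suffices, at the price of a multiple of \<open>|y|\<close>.
\<close>

lemma Cb_time_expansion:
  fixes \<psi> :: "real \<Rightarrow> 'a::euclidean_space \<Rightarrow> real"
  assumes "Cb_time (Suc (Suc k)) \<psi>" and t: "0 < t" and \<epsilon>: "0 < \<epsilon>"
  shows "\<exists>r>0. \<exists>C\<ge>0. r \<le> t \<and> (\<forall>\<delta> y. 0 < \<delta> \<and> \<delta> < r \<longrightarrow>
           \<bar>\<psi> (t - \<delta>) (x + y) - \<psi> t (x + y) + \<delta> * deriv (\<lambda>s. \<psi> s x) t\<bar> \<le> \<delta> * (\<epsilon> + C * norm y))"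
proof -
  obtain D where D: "\<And>t x. 0 < t \<Longrightarrow> ((\<lambda>s. \<psi> s x) has_real_derivative D t x) (at t)" and bc: "bdd_cont D"
    using assms(1) by auto
  obtain M where M: "0 \<le> M" "\<And>t x. 0 < t \<Longrightarrow> \<bar>D t x\<bar> \<le> M" using bdd_contE[OF bc] by blast
  have "continuous_on ({0<..} \<times> UNIV) (case_prod D)" using bc by (simp add: bdd_cont_def)
  then obtain d where d: "0 < d"
    "\<And>q. q \<in> {0<..} \<times> UNIV \<Longrightarrow> dist q (t, x) < d \<Longrightarrow> dist (case_prod D q) (case_prod D (t, x)) < \<epsilon>"
    using t \<epsilon> unfolding continuous_on_iff by (metis SigmaI UNIV_I greaterThan_iff)
  define r where "r = min t (d / 2)"
  \<comment> \<open>Chosen so that \<open>C |y|\<close> is at least the crude bound \<open>2 M\<close> as soon as \<open>|y| \<ge> d / 2\<close>.\<close>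
  define C where "C = 2 * M / (d / 2)"
  have C: "0 \<le> C" using M d by (simp add: C_def)
  have near: "\<bar>D s (x + y) - D t x\<bar> \<le> \<epsilon> + C * norm y" if s: "t - r < s" "s \<le> t" for s y
  proof (cases "norm y < d / 2")
    case True
    have s0: "0 < s" "\<bar>s - t\<bar> < d / 2" using s by (auto simp: r_def)
    have "dist (s, x + y) (t, x) \<le> \<bar>s - t\<bar> + norm y"
      using norm_Pair_le[of "s - t" y] by (simp add: dist_norm)
    then have "dist (case_prod D (s, x + y)) (case_prod D (t, x)) < \<epsilon>"
      using True s0 by (intro d) auto
    then show ?thesis using mult_nonneg_nonneg[OF C norm_ge_zero[of y]] by (simp add: dist_real_def)
  next
    case False
    have "0 < s" using s by (auto simp: r_def)
    then have "\<bar>D s (x + y) - D t x\<bar> \<le> 2 * M" using M(2)[of s "x + y"] M(2)[OF t, of x] by linarith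
    also have "\<dots> = C * (d / 2)" using d by (simp add: C_def)
    also have "\<dots> \<le> C * norm y" using False C by (intro mult_left_mono) auto
    finally show ?thesis using \<epsilon> by linarith
  qed
  have deriv: "deriv (\<lambda>s. \<psi> s x) t = D t x" using D[OF t] by (rule DERIV_imp_deriv)
  have "\<bar>\<psi> (t - \<delta>) (x + y) - \<psi> t (x + y) + \<delta> * deriv (\<lambda>s. \<psi> s x) t\<bar> \<le> \<delta> * (\<epsilon> + C * norm y)"
    if \<delta>: "0 < \<delta>" "\<delta> < r" for \<delta> y
  proof -
    obtain s where s: "t - \<delta> < s" "s < t"
      "\<psi> t (x + y) - \<psi> (t - \<delta>) (x + y) = (t - (t - \<delta>)) * D s (x + y)"
    proof -
      have "((\<lambda>s. \<psi> s (x + y)) has_real_derivative D s (x + y)) (at s)" if "t - \<delta> \<le> s" "s \<le> t" for s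
        using that \<delta> by (intro D) (auto simp: r_def)
      from MVT2[of "t - \<delta>" t "\<lambda>s. \<psi> s (x + y)", OF _ this] \<delta> that show thesis by auto
    qed
    have "\<psi> (t - \<delta>) (x + y) - \<psi> t (x + y) + \<delta> * deriv (\<lambda>s. \<psi> s x) t = - (\<delta> * (D s (x + y) - D t x))"
      using s(3) unfolding deriv by (simp add: algebra_simps)
    then have "\<bar>\<psi> (t - \<delta>) (x + y) - \<psi> t (x + y) + \<delta> * deriv (\<lambda>s. \<psi> s x) t\<bar> = \<delta> * \<bar>D s (x + y) - D t x\<bar>"
      using \<delta> by (simp add: abs_mult)
    also have "\<dots> \<le> \<delta> * (\<epsilon> + C * norm y)" using near[of s y] s \<delta> by (intro mult_left_mono) auto
    finally show ?thesis .
  qed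
  then show ?thesis using C t d(1) by (intro exI[of _ r] conjI exI[of _ C]) (auto simp: r_def)
qed

section \<open>The value function and its equation\<close>

context sublinear_convolution_semigroup
begin

lemma perturbation:
  assumes "0 \<le> t" and f: "lipschitz_fun f" and g: "lipschitz_fun g" and c: "0 \<le> c"
    and near: "\<And>y. \<bar>f y - (k + g y)\<bar> \<le> e + c * norm y"
  shows "\<bar>T t f - (k + T t g)\<bar> \<le> e + c * T t norm"
proof -
  have "T t f - T t (\<lambda>y. (k + e) + g y) \<le> c * T t norm"
  proof (intro diff_le_norm assms(1) c lipschitz_fun_intros f g)
    fix y show "f y - ((k + e) + g y) \<le> c * norm y" using near[of y] by linarith
  qed
  moreover have "T t (\<lambda>y. (k - e) + g y) - T t f \<le> c * T t norm"
  proof (intro diff_le_norm assms(1) c lipschitz_fun_intros f g)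
    fix y show "((k - e) + g y) - f y \<le> c * norm y" using near[of y] by linarith
  qed
  ultimately show ?thesis using add_const[OF assms(1) g, of "k + e"] add_const[OF assms(1) g, of "k - e"]
    by linarith
qed

definition generator :: "('a \<Rightarrow> real) \<Rightarrow> real" where
  "generator f = Lim (at_right 0) (\<lambda>\<delta>. T \<delta> f / \<delta>)"

text \<open>
  The increment from \<open>\<psi> t x\<close> to \<open>\<psi> (t - \<delta>) (x + y)\<close> splits into a spatial part, which produces the generator, and
  a temporal part, which up to an error \<open>\<delta> (\<epsilon> + C |y|)\<close> is the deterministic quantity
  \<open>- \<delta> \<partial>\<^sub>t \<psi>\<close>. Constants pass through a sublinear functional, so that part contributes exactly \<open>- \<partial>\<^sub>t \<psi>\<close>.
\<close>

lemma test_function_derivative: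
  assumes \<psi>: "Cb23 \<psi>" and t: "0 < t"
  shows "((\<lambda>\<delta>. (T \<delta> (\<lambda>y. \<psi> (t - \<delta>) (x + y)) - \<psi> t x) / \<delta>) \<longlongrightarrow>
           generator (\<lambda>z. \<psi> t (x + z) - \<psi> t x) - deriv (\<lambda>s. \<psi> s x) t) (at_right 0)"
proof -
  define f where "f z = \<psi> t (x + z) - \<psi> t x" for z
  define D where "D = deriv (\<lambda>s. \<psi> s x) t"
  define Q where "Q \<delta> = (T \<delta> (\<lambda>y. \<psi> (t - \<delta>) (x + y)) - \<psi> t x) / \<delta>" for \<delta>
  have time: "Cb_time (Suc (Suc 0)) \<psi>" and space: "Cb_space 3 \<psi>"
    using \<psi> by (simp_all add: Cb23_def numeral_2_eq_2)
  have \<psi>_lip: "lipschitz_fun (\<lambda>y. \<psi> s (x + y))" if "0 < s" for s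
    using Cb_space_Suc_lipschitz[of 2 \<psi>] space that
    by (intro lipschitz_fun_translate) (auto intro: lipschitz_funI)
  have f: "lipschitz_fun f" unfolding f_def by (intro lipschitz_fun_intros \<psi>_lip t)
  obtain w c where wc: "0 \<le> c" "\<And>x. norm (w x) \<le> c * norm x"
    "\<And>a y. \<bar>\<psi> t (x + a + y) - \<psi> t (x + a) - \<psi> t (x + y) + \<psi> t x - w a \<bullet> y\<bar> \<le> c * norm a * soft_norm y"
    using Cb_space_3_expansion[OF space t, of x] by blast
  have "\<exists>l. ((\<lambda>\<delta>. T \<delta> f / \<delta>) \<longlongrightarrow> l) (at_right 0)"
  proof (rule generator_exists[OF f _ wc(1,2)])
    fix a y show "\<bar>f (a + y) - f a - f y - w a \<bullet> y\<bar> \<le> c * norm a * soft_norm y"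
      using wc(3)[of a y] by (simp add: f_def algebra_simps)
  qed (simp add: f_def)
  then have lim: "((\<lambda>\<delta>. T \<delta> f / \<delta>) \<longlongrightarrow> generator f) (at_right 0)"
    unfolding generator_def using tendsto_Lim[OF trivial_limit_at_right_real] by blast
  have "((\<lambda>\<delta>. Q \<delta> - (T \<delta> f / \<delta> - D)) \<longlongrightarrow> 0) (at_right 0)"
  proof (rule tendstoI)
    fix e :: real assume e: "0 < e"
    obtain r C where rC: "0 < r" "0 \<le> C" "r \<le> t"
      and close: "\<And>\<delta> y. 0 < \<delta> \<Longrightarrow> \<delta> < r \<Longrightarrow>
           \<bar>\<psi> (t - \<delta>) (x + y) - \<psi> t (x + y) + \<delta> * D\<bar> \<le> \<delta> * (e / 2 + C * norm y)"
      using Cb_time_expansion[OF time t, of "e / 2" x] e unfolding D_def by auto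
    have "((\<lambda>\<delta>. e / 2 + C * T \<delta> norm) \<longlongrightarrow> e / 2 + C * 0) (at_right 0)"
      by (intro tendsto_intros norm_tendsto_0)
    then have "\<forall>\<^sub>F \<delta> in at_right 0. e / 2 + C * T \<delta> norm < e"
      by (rule order_tendstoD) (use e in simp)
    moreover have "\<forall>\<^sub>F \<delta> in at_right 0. \<delta> \<in> {0<..<r}" using rC by (intro eventually_at_right_real)
    ultimately show "\<forall>\<^sub>F \<delta> in at_right 0. dist (Q \<delta> - (T \<delta> f / \<delta> - D)) 0 < e"
    proof eventually_elim
      case (elim \<delta>)
      then have \<delta>: "0 < \<delta>" "\<delta> < r" by auto
      have "\<bar>T \<delta> (\<lambda>y. \<psi> (t - \<delta>) (x + y)) - ((\<psi> t x - \<delta> * D) + T \<delta> f)\<bar> \<le> \<delta> * (e / 2) + (\<delta> * C) * T \<delta> norm"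
      proof (rule perturbation[OF _ \<psi>_lip f])
        fix y show "\<bar>\<psi> (t - \<delta>) (x + y) - ((\<psi> t x - \<delta> * D) + f y)\<bar> \<le> \<delta> * (e / 2) + \<delta> * C * norm y"
          using close[OF \<delta>, of y] by (simp add: f_def algebra_simps)
      qed (use \<delta> rC in auto)
      also have "\<dots> = \<delta> * (e / 2 + C * T \<delta> norm)" by (simp add: algebra_simps)
      also have "\<dots> < \<delta> * e" using elim \<delta> by (intro mult_strict_left_mono) auto
      finally have "\<bar>T \<delta> (\<lambda>y. \<psi> (t - \<delta>) (x + y)) - ((\<psi> t x - \<delta> * D) + T \<delta> f)\<bar> < \<delta> * e" .
      moreover have "\<delta> * (Q \<delta> - (T \<delta> f / \<delta> - D))
          = T \<delta> (\<lambda>y. \<psi> (t - \<delta>) (x + y)) - ((\<psi> t x - \<delta> * D) + T \<delta> f)"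
      proof -
        have "\<delta> * Q \<delta> = T \<delta> (\<lambda>y. \<psi> (t - \<delta>) (x + y)) - \<psi> t x" using \<delta> by (simp add: Q_def)
        moreover have "\<delta> * (T \<delta> f / \<delta>) = T \<delta> f" using \<delta> by simp
        ultimately show ?thesis by (simp only: right_diff_distrib)
      qed
      ultimately have "\<bar>\<delta> * (Q \<delta> - (T \<delta> f / \<delta> - D))\<bar> < \<delta> * e" by (simp only:)
      then show ?case using \<delta> by (simp add: abs_mult)
    qed
  qed
  from tendsto_add[OF this tendsto_diff[OF lim tendsto_const[of D]]]
  have "((\<lambda>\<delta>. Q \<delta>) \<longlongrightarrow> generator f - D) (at_right 0)" by simp
  then show ?thesis unfolding Q_def D_def f_def .
qed

lemma dynamic_programming:
  assumes "0 \<le> \<delta>" "\<delta> \<le> t" "lipschitz_fun \<phi>"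
  shows "T t (\<lambda>z. \<phi> (x + z)) = T \<delta> (\<lambda>y. T (t - \<delta>) (\<lambda>z. \<phi> (x + y + z)))"
  using convolution[OF assms(1) _ lipschitz_fun_translate[OF assms(3)], of "t - \<delta>" x] assms(2)
  by (simp add: add.assoc)

lemma lipschitz_fun_value:
  assumes "0 \<le> t" "lipschitz_fun \<phi>"
  shows "lipschitz_fun (\<lambda>y. T t (\<lambda>z. \<phi> (x + y + z)))"
  using lipschitz_fun_translate[OF lipschitz_fun_semigroup[OF assms], of x] .

lemma continuous_on_value:
  assumes "lipschitz_fun \<phi>"
  shows "continuous_on ({0..} \<times> UNIV) (\<lambda>(t, x). T t (\<lambda>z. \<phi> (x + z)))"
proof -
  obtain L where L: "0 \<le> L" "\<And>x y. \<bar>\<phi> x - \<phi> y\<bar> \<le> L * norm (x - y)" using lipschitz_funE[OF assms] by blast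
  define u where "u t x = T t (\<lambda>z. \<phi> (x + z))" for t x
  have time: "\<bar>u t x - u s x\<bar> \<le> L * T \<bar>t - s\<bar> norm" if ts: "0 \<le> t" "0 \<le> s" for t s x
  proof -
    have *: "\<bar>u (a + d) x - u a x\<bar> \<le> L * T d norm" if "0 \<le> a" "0 \<le> d" for a d
      unfolding u_def
    proof (rule time_increment[OF that L(1)])
      fix y z show "\<bar>\<phi> (x + y) - \<phi> (x + z)\<bar> \<le> L * norm (y - z)" using L(2)[of "x + y" "x + z"] by simp
    qed
    show ?thesis
    proof (cases "s \<le> t")
      case True then show ?thesis using *[of s "t - s"] ts by simp
    next
      case False then show ?thesis using *[of t "s - t"] ts by (simp add: abs_minus_commute)
    qed
  qed
  have joint: "\<bar>u t x - u s y\<bar> \<le> L * T \<bar>t - s\<bar> norm + L * norm (x - y)" if ts: "0 \<le> t" "0 \<le> s" for t s x y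
    using time[OF ts, of x] translate_lipschitz[OF ts(2) L, of x y] unfolding u_def by linarith
  have "continuous_on ({0..} \<times> UNIV) (case_prod u)"
  proof (rule iffD2[OF continuous_on_iff], intro ballI allI impI)
    fix p :: "real \<times> 'a" and e :: real assume p: "p \<in> {0..} \<times> UNIV" and e: "0 < e"
    define k where "k = e / (2 * (L + 1))"
    have k: "0 < k" "2 * (L + 1) * k = e" using e L(1) by (simp_all add: k_def)
    have "\<forall>\<^sub>F r in at_right 0. T r norm < k"
      using norm_tendsto_0 k(1) by (rule order_tendstoD)
    then obtain d where d: "0 < d" "\<And>r. 0 < r \<Longrightarrow> r < d \<Longrightarrow> T r norm < k"
      unfolding eventually_at_right_field by auto
    have d': "T r norm < k" if "0 \<le> r" "r < d" for r
      using that d(2)[of r] k(1) by (cases "r = 0") (auto simp: at_zero)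
    have "dist (case_prod u q) (case_prod u p) < e"
      if q: "q \<in> {0..} \<times> UNIV" and qp: "dist q p < min d k" for q
    proof -
      have "\<bar>fst q - fst p\<bar> < d" using dist_fst_le[of q p] qp by (simp add: dist_real_def)
      then have a: "T \<bar>fst q - fst p\<bar> norm < k" by (intro d') auto
      have b: "norm (snd q - snd p) < k" using dist_snd_le[of q p] qp by (simp add: dist_norm)
      have "\<bar>u (fst q) (snd q) - u (fst p) (snd p)\<bar>
          \<le> L * T \<bar>fst q - fst p\<bar> norm + L * norm (snd q - snd p)"
        using p q by (intro joint) auto
      also have "\<dots> \<le> L * k + L * k"
        using a b L(1) by (intro add_mono mult_left_mono) auto
      also have "\<dots> < 2 * (L + 1) * k" using k(1) by (simp add: algebra_simps)
      also have "\<dots> = e" by (rule k(2))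
      finally show ?thesis by (simp add: dist_real_def case_prod_beta)
    qed
    then show "\<exists>d>0. \<forall>q\<in>{0..} \<times> UNIV. dist q p < d \<longrightarrow> dist (case_prod u q) (case_prod u p) < e"
      using d(1) k(1) by (intro exI[of _ "min d k"]) auto
  qed
  then show ?thesis unfolding u_def .
qed

text \<open>
  At a touching point the dynamic programming principle reads
  \<open>\<psi> t x = T \<delta> (\<lambda>y. u (t - \<delta>) (x + y))\<close>. Replacing \<open>u\<close> by a test function on one side of it and
  differentiating at \<open>\<delta> = 0\<close> by \<open>test_function_derivative\<close> gives the respective inequality.
\<close>

theorem value_is_viscosity_solution:
  assumes bdd: "bounded (range \<phi>)" and \<phi>: "lipschitz_fun \<phi>"
  shows "viscosity_solution generator \<phi> (\<lambda>t x. T t (\<lambda>z. \<phi> (x + z)))"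
proof -
  define u where "u t x = T t (\<lambda>z. \<phi> (x + z))" for t x
  obtain M where M: "\<And>x. \<bar>\<phi> x\<bar> \<le> M" using bdd by (auto simp: bounded_iff)
  have "\<bar>u t x\<bar> \<le> M" if "0 \<le> t" for t x
    unfolding u_def using M by (intro abs_le_bound that lipschitz_fun_translate \<phi>)
  then have bounded: "bounded (case_prod u ` ({0..} \<times> UNIV))" unfolding bounded_iff by (intro exI[of _ M]) auto
  have cont: "continuous_on ({0..} \<times> UNIV) (case_prod u)"
    using continuous_on_value[OF \<phi>] unfolding u_def .
  then have lim: "(case_prod u \<longlongrightarrow> case_prod u p) (at p within {0..} \<times> UNIV)" if "p \<in> {0..} \<times> UNIV" for p
    using that unfolding continuous_on_def by (rule bspec)
  have usc: "usc_on ({0..} \<times> UNIV) (case_prod u)" unfolding usc_on_def using lim order_tendstoD(2) by blast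
  have lsc: "lsc_on ({0..} \<times> UNIV) (case_prod u)" unfolding lsc_on_def using lim order_tendstoD(1) by blast
  have init: "u 0 x = \<phi> x" for x by (simp add: u_def at_zero)
  have dpp: "u t x = T \<delta> (\<lambda>y. u (t - \<delta>) (x + y))" if "0 \<le> \<delta>" "\<delta> \<le> t" for t x \<delta>
    unfolding u_def by (rule dynamic_programming[OF that \<phi>])
  have u_lip: "lipschitz_fun (\<lambda>y. u s (x + y))" if "0 \<le> s" for s x
    unfolding u_def by (rule lipschitz_fun_value[OF that \<phi>])
  have \<psi>_lip: "lipschitz_fun (\<lambda>y. \<psi> s (x + y))" if "0 < s" "Cb23 \<psi>" for s x and \<psi> :: "real \<Rightarrow> 'a \<Rightarrow> real"
    using Cb_space_Suc_lipschitz[of 2 \<psi>] that unfolding Cb23_def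
    by (intro lipschitz_fun_translate) (auto intro: lipschitz_funI)
  have small: "\<forall>\<^sub>F \<delta> in at_right 0. \<delta> \<in> {0<..<t}" if "0 < t" for t :: real
    using that by (rule eventually_at_right_real)
  have sub: "deriv (\<lambda>s. \<psi> s x) t - generator (\<lambda>z. \<psi> t (x + z) - \<psi> t x) \<le> 0"
    if t: "0 < t" and \<psi>: "Cb23 \<psi>" and above: "\<forall>s>0. \<forall>y. u s y \<le> \<psi> s y" and touch: "\<psi> t x = u t x" for t x \<psi>
  proof -
    have "\<forall>\<^sub>F \<delta> in at_right 0. 0 \<le> (T \<delta> (\<lambda>y. \<psi> (t - \<delta>) (x + y)) - \<psi> t x) / \<delta>"
      using small[OF t]
    proof eventually_elim
      case (elim \<delta>)
      then have "T \<delta> (\<lambda>y. u (t - \<delta>) (x + y)) \<le> T \<delta> (\<lambda>y. \<psi> (t - \<delta>) (x + y))"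
        using above by (intro mono u_lip \<psi>_lip \<psi>) auto
      then show ?case using dpp[of \<delta> t x] elim touch by simp
    qed
    from tendsto_lowerbound[OF test_function_derivative[OF \<psi> t] this] show ?thesis by simp
  qed
  have super: "0 \<le> deriv (\<lambda>s. \<psi> s x) t - generator (\<lambda>z. \<psi> t (x + z) - \<psi> t x)"
    if t: "0 < t" and \<psi>: "Cb23 \<psi>" and below: "\<forall>s>0. \<forall>y. \<psi> s y \<le> u s y" and touch: "\<psi> t x = u t x" for t x \<psi>
  proof -
    have "\<forall>\<^sub>F \<delta> in at_right 0. (T \<delta> (\<lambda>y. \<psi> (t - \<delta>) (x + y)) - \<psi> t x) / \<delta> \<le> 0"
      using small[OF t]
    proof eventually_elim
      case (elim \<delta>)
      then have "T \<delta> (\<lambda>y. \<psi> (t - \<delta>) (x + y)) \<le> T \<delta> (\<lambda>y. u (t - \<delta>) (x + y))"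
        using below by (intro mono u_lip \<psi>_lip \<psi>) auto
      then show ?case using dpp[of \<delta> t x] elim touch by (simp add: divide_le_0_iff)
    qed
    from tendsto_upperbound[OF test_function_derivative[OF \<psi> t] this] show ?thesis by simp
  qed
  have "viscosity_solution generator \<phi> u"
    unfolding viscosity_solution_def viscosity_subsolution_def viscosity_supersolution_def
    using bounded cont usc lsc init sub super by auto
  then show ?thesis by (simp add: u_def[abs_def])
qed

end

section \<open>Levy processes as convolution semigroups\<close>

context sublinear_expectation
begin

text \<open>
  The closure of \<open>H\<close> is available for finite tuples of real random variables, so \<open>Z\<close> is
  reassembled from its coordinates along an enumeration of the basis.
\<close>

lemma lipschitz_random_vector:
  fixes Z :: "'w \<Rightarrow> 'a::euclidean_space"
  assumes Z: "random_vector H Z" and f: "lipschitz_fun f"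
  shows "(\<lambda>\<omega>. f (Z \<omega>)) \<in> H"
proof -
  obtain L where L: "0 \<le> L" "\<And>x y. \<bar>f x - f y\<bar> \<le> L * norm (x - y)" using lipschitz_funE[OF f] by blast
  obtain e where e: "bij_betw e {..<DIM('a)} (Basis :: 'a set)"
    using ex_bij_betw_nat_finite[OF finite_Basis] by (auto simp: atLeast0LessThan)
  define g where "g z = f (\<Sum>i<DIM('a). z i *\<^sub>R e i)" for z :: "nat \<Rightarrow> real"
  have eB: "e i \<in> Basis" if "i < DIM('a)" for i using e that by (auto simp: bij_betw_def)
  have "\<bar>g x - g y\<bar> \<le> L * (\<Sum>i<DIM('a). norm (x i - y i))" for x y
  proof -
    have "\<bar>g x - g y\<bar> \<le> L * norm (\<Sum>i<DIM('a). (x i - y i) *\<^sub>R e i)"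
      using L(2) unfolding g_def by (simp add: scaleR_diff_left sum_subtractf)
    also have "\<dots> \<le> L * (\<Sum>i<DIM('a). norm ((x i - y i) *\<^sub>R e i))"
      using L(1) by (intro mult_left_mono norm_sum)
    also have "(\<Sum>i<DIM('a). norm ((x i - y i) *\<^sub>R e i)) = (\<Sum>i<DIM('a). norm (x i - y i))"
      using eB by (intro sum.cong) auto
    finally show ?thesis .
  qed
  then have "lip_fun DIM('a) g" unfolding lip_fun_def by blast
  then have "(\<lambda>\<omega>. g (\<lambda>i. Z \<omega> \<bullet> e i)) \<in> H"
    using Z eB by (intro lip_closed[where Z = "\<lambda>i \<omega>. Z \<omega> \<bullet> e i"]) (auto simp: random_vector_def)
  moreover have "g (\<lambda>i. Z \<omega> \<bullet> e i) = f (Z \<omega>)" for \<omega>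
    using sum.reindex_bij_betw[OF e, of "\<lambda>b. (Z \<omega> \<bullet> b) *\<^sub>R b"]
    by (simp add: g_def euclidean_representation)
  ultimately show ?thesis by simp
qed

lemma expectation_add_le:
  assumes "X \<in> H" "Y \<in> H" shows "E (\<lambda>\<omega>. X \<omega> + Y \<omega>) \<le> E X + E Y"
  using subadd[OF add_closed[OF assms] assms(2)] by simp

end

text \<open>
  The assumption \<open>vanishing\<close> is the consequence of the decomposition of a \<open>G\<close>-Levy process that
  makes the error in almost additivity of higher order.
\<close>

locale Levy_vanishing_at_0 = sublinear_expectation H E
  for H :: "('w \<Rightarrow> real) set" and E :: "('w \<Rightarrow> real) \<Rightarrow> real" +
  fixes X :: "real \<Rightarrow> 'w \<Rightarrow> 'a::euclidean_space"
  assumes Levy: "Levy_process H E X"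
    and vanishing: "((\<lambda>t. E (\<lambda>\<omega>. norm (X t \<omega>))) \<longlongrightarrow> 0) (at_right 0)"
begin

lemma lipschitz_in_H: "0 \<le> t \<Longrightarrow> lipschitz_fun f \<Longrightarrow> (\<lambda>\<omega>. f (X t \<omega>)) \<in> H"
  using Levy by (intro lipschitz_random_vector) (auto simp: Levy_process_def)

lemma X_0: "X 0 \<omega> = 0"
  using Levy by (simp add: Levy_process_def)

lemma increment_expectation:
  assumes "0 \<le> t" "0 < s" "lipschitz_fun f"
  shows "E (\<lambda>\<omega>. f (X (t + s) \<omega> - X t \<omega>)) = E (\<lambda>\<omega>. f (X s \<omega>))"
proof -
  have "identically_distributed E (\<lambda>\<omega>. X (t + s) \<omega> - X t \<omega>) E (\<lambda>\<omega>. X (0 + s) \<omega> - X 0 \<omega>)"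
    using Levy assms(1,2) unfolding Levy_process_def by blast
  then show ?thesis using assms(3) by (auto simp: X_0 identically_distributed_def lipschitz_fun_def)
qed

lemma convolution_property:
  assumes t: "0 < t" and s: "0 < s" and f: "lipschitz_fun f"
  shows "E (\<lambda>\<omega>. f (X (t + s) \<omega>)) = E (\<lambda>\<omega>. E (\<lambda>\<omega>'. f (X t \<omega> + X s \<omega>')))"
proof -
  obtain L where L: "0 \<le> L" "\<And>x y. \<bar>f x - f y\<bar> \<le> L * norm (x - y)" using lipschitz_funE[OF f] by blast
  have indep: "indep_of_tuple E (\<lambda>\<omega>. X (t + s) \<omega> - X t \<omega>) 1 (\<lambda>i. X t)"
    using Levy t s unfolding Levy_process_def by (auto simp: mono_on_def)
  define \<phi> where "\<phi> z y = f (z 0 + y)" for z :: "nat \<Rightarrow> 'a" and y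
  have "\<bar>\<phi> x y - \<phi> x' y'\<bar> \<le> L * ((\<Sum>i<1. norm (x i - x' i)) + norm (y - y'))" for x y x' y'
  proof -
    have "\<bar>\<phi> x y - \<phi> x' y'\<bar> \<le> L * norm ((x 0 - x' 0) + (y - y'))"
      using L(2)[of "x 0 + y" "x' 0 + y'"] by (simp add: \<phi>_def algebra_simps)
    also have "\<dots> \<le> L * (norm (x 0 - x' 0) + norm (y - y'))"
      using L(1) by (intro mult_left_mono norm_triangle_ineq)
    finally show ?thesis by simp
  qed
  then have "E (\<lambda>\<omega>. \<phi> (\<lambda>i. X t \<omega>) (X (t + s) \<omega> - X t \<omega>))
      = E (\<lambda>\<omega>. E (\<lambda>\<omega>'. \<phi> (\<lambda>i. X t \<omega>) (X (t + s) \<omega>' - X t \<omega>')))"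
    using indep unfolding indep_of_tuple_def by blast
  moreover have "E (\<lambda>\<omega>'. f (x + (X (t + s) \<omega>' - X t \<omega>'))) = E (\<lambda>\<omega>'. f (x + X s \<omega>'))" for x
    using t by (intro increment_expectation s lipschitz_fun_translate f) simp
  ultimately show ?thesis by (simp add: \<phi>_def)
qed

sublocale sublinear_convolution_semigroup "\<lambda>t f. E (\<lambda>\<omega>. f (X t \<omega>))"
proof
  fix t :: real and f g :: "'a \<Rightarrow> real" assume t: "0 \<le> t" and f: "lipschitz_fun f"
  show "0 \<le> s \<Longrightarrow> E (\<lambda>\<omega>. f (X (t + s) \<omega>)) = E (\<lambda>\<omega>. E (\<lambda>\<omega>'. f (X t \<omega> + X s \<omega>')))" for s
  proof -
    assume s: "0 \<le> s"
    consider "t = 0" | "s = 0" | "0 < t" "0 < s" using t s by force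
    then show ?thesis
    proof cases
      case 1 then show ?thesis using const by (simp add: X_0)
    next
      case 2 then show ?thesis using const by (simp add: X_0)
    next
      case 3 then show ?thesis using f by (rule convolution_property)
    qed
  qed
  show "0 \<le> c \<Longrightarrow> E (\<lambda>\<omega>. c * f (X t \<omega>)) = c * E (\<lambda>\<omega>. f (X t \<omega>))" for c
    by (rule pos_homogeneous[OF lipschitz_in_H[OF t f]])
  assume g: "lipschitz_fun g"
  show "(\<And>x. f x \<le> g x) \<Longrightarrow> E (\<lambda>\<omega>. f (X t \<omega>)) \<le> E (\<lambda>\<omega>. g (X t \<omega>))"
    by (rule monotone[OF lipschitz_in_H[OF t g] lipschitz_in_H[OF t f]]) simp
  show "E (\<lambda>\<omega>. f (X t \<omega>) + g (X t \<omega>)) \<le> E (\<lambda>\<omega>. f (X t \<omega>)) + E (\<lambda>\<omega>. g (X t \<omega>))"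
    by (rule expectation_add_le[OF lipschitz_in_H[OF t f] lipschitz_in_H[OF t g]])
qed (use const vanishing in \<open>auto simp: X_0\<close>)

end

lemma norm_cube_in_H:
  fixes Xc Xd :: "real \<Rightarrow> 'v \<Rightarrow> 'a::euclidean_space"
  assumes "integrability_convention H Xc Xd" and t: "0 \<le> t"
  shows "(\<lambda>\<omega>. norm (Xc t \<omega>) ^ 3) \<in> H"
proof -
  define \<psi> where "\<psi> x y = norm (x 0) ^ 3" for x y :: "nat \<Rightarrow> 'a"
  have cube: "\<bar>a ^ 3 - b ^ 3\<bar> \<le> 3 * R\<^sup>2 * \<bar>a - b\<bar>" if "0 \<le> a" "0 \<le> b" "a \<le> R" "b \<le> R" for a b R :: real
  proof -
    have "a ^ 3 - b ^ 3 = (a\<^sup>2 + a * b + b\<^sup>2) * (a - b)" by algebra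
    moreover have "a\<^sup>2 + a * b + b\<^sup>2 \<le> 3 * R\<^sup>2"
      using power_mono[OF that(3,1), of 2] power_mono[OF that(4,2), of 2] mult_mono[OF that(3,4)] that
      by (simp add: power2_eq_square)
    moreover have "0 \<le> a\<^sup>2 + a * b + b\<^sup>2" using that by simp
    ultimately show ?thesis by (simp add: abs_mult mult_right_mono)
  qed
  have "loc_lip_fun 1 0 \<psi>"
    unfolding loc_lip_fun_def Let_def
  proof (intro allI)
    fix x y :: "nat \<Rightarrow> 'a"
    define R where "R = norm (x 0) + 1"
    have "\<bar>\<psi> x1 y1 - \<psi> x2 y2\<bar> \<le> 3 * R\<^sup>2 * norm (x1 0 - x2 0)"
      if "norm (x 0 - x1 0) < 1" "norm (x 0 - x2 0) < 1" for x1 y1 x2 y2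
    proof -
      have "norm (x1 0) \<le> R" "norm (x2 0) \<le> R"
        using that norm_triangle_ineq2[of "x1 0" "x 0"] norm_triangle_ineq2[of "x2 0" "x 0"]
        by (simp_all add: R_def norm_minus_commute)
      then have "\<bar>\<psi> x1 y1 - \<psi> x2 y2\<bar> \<le> 3 * R\<^sup>2 * \<bar>norm (x1 0) - norm (x2 0)\<bar>"
        unfolding \<psi>_def by (intro cube) auto
      also have "\<dots> \<le> 3 * R\<^sup>2 * norm (x1 0 - x2 0)"
        by (intro mult_left_mono norm_triangle_ineq3) auto
      finally show ?thesis .
    qed
    then show "\<exists>r>0. \<exists>L. \<forall>x1 y1 x2 y2.
        (\<Sum>i<1. norm (x i - x1 i)) + (\<Sum>j<0. norm (y j - y1 j)) < r \<and>
        (\<Sum>i<1. norm (x i - x2 i)) + (\<Sum>j<0. norm (y j - y2 j)) < r \<longrightarrow>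
        \<bar>\<psi> x1 y1 - \<psi> x2 y2\<bar> \<le> L * ((\<Sum>i<1. norm (x1 i - x2 i)) + (\<Sum>j<0. norm (y1 j - y2 j)))"
      by (intro exI[of _ 1] conjI exI[of _ "3 * R\<^sup>2"]) auto
  qed
  moreover have "\<forall>x y. \<bar>\<psi> x y\<bar> \<le> 1 * (1 + (\<Sum>i<1. norm (x i)) ^ 3 + (\<Sum>j<0. norm (y j)))"
    by (simp add: \<psi>_def)
  ultimately have "(\<lambda>\<omega>. \<psi> (\<lambda>i. Xc t \<omega>) (\<lambda>j. Xd t \<omega>)) \<in> H"
    using assms(1)[unfolded integrability_convention_def, rule_format, of 1 "\<lambda>_. t" 0 "\<lambda>_. t" \<psi> 1] t
    by simp
  then show ?thesis by (simp add: \<psi>_def)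
qed

text \<open>
  From \<open>r \<le> \<epsilon> + r\<^sup>3 / \<epsilon>\<^sup>2\<close> with \<open>r = |X\<^sup>c t|\<close>, the third moment of the continuous part being \<open>o(t)\<close>
  and the first moment of the jump part \<open>O(t)\<close>, the first moment of \<open>X t\<close> is at most
  \<open>\<epsilon> + o(1)\<close> for every \<open>\<epsilon> > 0\<close>.
\<close>

lemma G_Levy_norm_tendsto_0:
  fixes X :: "real \<Rightarrow> 'w \<Rightarrow> 'a::euclidean_space"
  assumes "sublinear_expectation H E" and G: "G_Levy_process TYPE('v) H E X"
  shows "((\<lambda>t. E (\<lambda>\<omega>. norm (X t \<omega>))) \<longlongrightarrow> 0) (at_right 0)"
proof -
  obtain H' :: "('v \<Rightarrow> real) set" and E' Xc Xd C
    where se: "sublinear_expectation H' E'" and ic: "integrability_convention H' Xc Xd"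
      and LP: "Levy_process H' E' (\<lambda>t \<omega>. (Xc t \<omega>, Xd t \<omega>))"
      and fdd: "same_fin_dim_distributions E' (\<lambda>t \<omega>. Xc t \<omega> + Xd t \<omega>) E X"
      and cube: "((\<lambda>t. E' (\<lambda>\<omega>. norm (Xc t \<omega>) ^ 3) / t) \<longlongrightarrow> 0) (at_right 0)"
      and jump: "\<forall>t\<ge>0. E' (\<lambda>\<omega>. norm (Xd t \<omega>)) \<le> C * t"
    using G unfolding G_Levy_process_def by blast
  interpret X: sublinear_expectation H E by fact
  interpret P: sublinear_expectation H' E' by fact
  define q where "q t = E' (\<lambda>\<omega>. norm (Xc t \<omega>) ^ 3)" for t
  have same: "E' (\<lambda>\<omega>. norm (Xc t \<omega> + Xd t \<omega>)) = E (\<lambda>\<omega>. norm (X t \<omega>))" if "0 \<le> t" for t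
  proof -
    have "lip_fun 1 (\<lambda>x. norm (x 0) :: real)" for x :: "nat \<Rightarrow> 'a"
      unfolding lip_fun_def by (intro exI[of _ 1]) (simp add: norm_triangle_ineq3)
    then show ?thesis
      using fdd[unfolded same_fin_dim_distributions_def, rule_format, of 1 "\<lambda>_. t" "\<lambda>x. norm (x 0)"] that
      by simp
  qed
  have bound: "E (\<lambda>\<omega>. norm (X t \<omega>)) \<le> \<epsilon> + 1 / \<epsilon>\<^sup>2 * (q t / t * t) + C * t"
    if t: "0 < t" and \<epsilon>: "0 < \<epsilon>" for t \<epsilon>
  proof -
    have t0: "0 \<le> t" using t by simp
    have rv: "random_vector H' (\<lambda>\<omega>. (Xc t \<omega>, Xd t \<omega>))" using LP t0 by (simp add: Levy_process_def)
    have in_H: "(\<lambda>\<omega>. f (Xc t \<omega>, Xd t \<omega>)) \<in> H'" if "lipschitz_fun f" for f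
      using rv that by (rule P.lipschitz_random_vector)
    have "lipschitz_fun (\<lambda>p :: 'a \<times> 'a. norm (snd p))"
    proof (rule lipschitz_funI[of _ 1])
      fix p r :: "'a \<times> 'a"
      have "\<bar>norm (snd p) - norm (snd r)\<bar> \<le> norm (snd (p - r))" by (simp add: norm_triangle_ineq3)
      also have "\<dots> \<le> 1 * norm (p - r)" using norm_snd_le[of "snd (p - r)" "fst (p - r)"]
        by (simp only: prod.collapse mult_1)
      finally show "\<bar>norm (snd p) - norm (snd r)\<bar> \<le> 1 * norm (p - r)" .
    qed
    from in_H[OF this] have d: "(\<lambda>\<omega>. norm (Xd t \<omega>)) \<in> H'" by simp
    have "lipschitz_fun (\<lambda>p :: 'a \<times> 'a. norm (fst p + snd p))"
    proof (rule lipschitz_funI[of _ 2])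
      fix p r :: "'a \<times> 'a"
      have "\<bar>norm (fst p + snd p) - norm (fst r + snd r)\<bar> \<le> norm (fst (p - r) + snd (p - r))"
        using norm_triangle_ineq3[of "fst p + snd p" "fst r + snd r"] by (simp add: algebra_simps)
      also have "\<dots> \<le> norm (fst (p - r)) + norm (snd (p - r))" by (rule norm_triangle_ineq)
      also have "\<dots> \<le> norm (p - r) + norm (p - r)"
        using norm_fst_le[of "fst (p - r)" "snd (p - r)"] norm_snd_le[of "snd (p - r)" "fst (p - r)"]
        unfolding prod.collapse by (rule add_mono)
      finally show "\<bar>norm (fst p + snd p) - norm (fst r + snd r)\<bar> \<le> 2 * norm (p - r)" by simp
    qed
    from in_H[OF this] have s: "(\<lambda>\<omega>. norm (Xc t \<omega> + Xd t \<omega>)) \<in> H'" by simp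
    have k: "(\<lambda>\<omega>. 1 / \<epsilon>\<^sup>2 * norm (Xc t \<omega>) ^ 3) \<in> H'" by (intro P.scale_closed norm_cube_in_H[OF ic t0])
    have e: "(\<lambda>\<omega>. \<epsilon>) \<in> H'" using in_H[OF lipschitz_fun_const] .
    have young: "r \<le> \<epsilon> + 1 / \<epsilon>\<^sup>2 * r ^ 3" if "0 \<le> r" for r :: real
    proof (cases "r \<le> \<epsilon>")
      case True then show ?thesis using that \<epsilon> by (simp add: add_increasing2)
    next
      case False
      then have "\<epsilon>\<^sup>2 * r \<le> r\<^sup>2 * r" using \<epsilon> by (intro mult_right_mono power_mono) auto
      then have "r \<le> 1 / \<epsilon>\<^sup>2 * r ^ 3" using \<epsilon> by (simp add: field_simps power3_eq_cube power2_eq_square)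
      then show ?thesis using \<epsilon> by linarith
    qed
    have "E (\<lambda>\<omega>. norm (X t \<omega>)) = E' (\<lambda>\<omega>. norm (Xc t \<omega> + Xd t \<omega>))" using same t by simp
    also have "\<dots> \<le> E' (\<lambda>\<omega>. (\<epsilon> + 1 / \<epsilon>\<^sup>2 * norm (Xc t \<omega>) ^ 3) + norm (Xd t \<omega>))"
    proof (rule P.monotone)
      show "\<forall>\<omega>. norm (Xc t \<omega> + Xd t \<omega>) \<le> (\<epsilon> + 1 / \<epsilon>\<^sup>2 * norm (Xc t \<omega>) ^ 3) + norm (Xd t \<omega>)"
        using young[OF norm_ge_zero] norm_triangle_ineq by (meson add_right_mono order_trans)
    qed (intro P.add_closed e k d s)+
    also have "\<dots> \<le> E' (\<lambda>\<omega>. \<epsilon> + 1 / \<epsilon>\<^sup>2 * norm (Xc t \<omega>) ^ 3) + E' (\<lambda>\<omega>. norm (Xd t \<omega>))"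
      by (intro P.expectation_add_le P.add_closed e k d)
    also have "E' (\<lambda>\<omega>. \<epsilon> + 1 / \<epsilon>\<^sup>2 * norm (Xc t \<omega>) ^ 3) \<le> E' (\<lambda>\<omega>. \<epsilon>) + E' (\<lambda>\<omega>. 1 / \<epsilon>\<^sup>2 * norm (Xc t \<omega>) ^ 3)"
      by (intro P.expectation_add_le e k)
    also have "E' (\<lambda>\<omega>. 1 / \<epsilon>\<^sup>2 * norm (Xc t \<omega>) ^ 3) = 1 / \<epsilon>\<^sup>2 * q t"
      unfolding q_def by (intro P.pos_homogeneous norm_cube_in_H[OF ic t0]) simp
    also have "E' (\<lambda>\<omega>. \<epsilon>) = \<epsilon>" by (rule P.const)
    finally have "E (\<lambda>\<omega>. norm (X t \<omega>)) \<le> \<epsilon> + 1 / \<epsilon>\<^sup>2 * q t + E' (\<lambda>\<omega>. norm (Xd t \<omega>))" by simp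
    moreover have "E' (\<lambda>\<omega>. norm (Xd t \<omega>)) \<le> C * t" using jump t by simp
    moreover have "q t / t * t = q t" using t by simp
    ultimately show ?thesis by simp
  qed
  show ?thesis
  proof (rule tendstoI)
    fix e :: real assume e: "0 < e"
    have "((\<lambda>t. e / 2 + 1 / (e / 2)\<^sup>2 * (q t / t * t) + C * t) \<longlongrightarrow> e / 2 + 1 / (e / 2)\<^sup>2 * (0 * 0) + C * 0) (at_right 0)"
      using cube unfolding q_def by (intro tendsto_intros)
    then have "\<forall>\<^sub>F t in at_right 0. e / 2 + 1 / (e / 2)\<^sup>2 * (q t / t * t) + C * t < e"
      by (rule order_tendstoD) (use e in simp)
    moreover have "\<forall>\<^sub>F t::real in at_right 0. 0 < t" by (rule eventually_at_right_less)
    ultimately show "\<forall>\<^sub>F t in at_right 0. dist (E (\<lambda>\<omega>. norm (X t \<omega>))) 0 < e"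
    proof eventually_elim
      case (elim t)
      have rv: "random_vector H (X t)" using G elim(2) by (simp add: G_Levy_process_def Levy_process_def)
      have "E (\<lambda>_. 0) \<le> E (\<lambda>\<omega>. norm (X t \<omega>))"
        by (intro X.monotone X.zero_closed X.lipschitz_random_vector[OF rv] lipschitz_fun_norm) simp
      then show ?case using bound[OF elim(2), of "e / 2"] elim(1) e X.const[of 0] by simp
    qed
  qed
qed

theorem theorem31:
  fixes H :: "('w \<Rightarrow> real) set"
    and E :: "('w \<Rightarrow> real) \<Rightarrow> real"
    and X :: "real \<Rightarrow> 'w \<Rightarrow> real ^ 'd"
    and \<phi> :: "real ^ 'd \<Rightarrow> real"
    and L :: real
  assumes "sublinear_expectation H E"
    and "G_Levy_process TYPE('v) H E X"
    and "bounded (range \<phi>)"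
    and "L-lipschitz_on UNIV \<phi>"
  shows "viscosity_solution (G_gen E X) \<phi> (\<lambda>t x. E (\<lambda>\<omega>. \<phi> (x + X t \<omega>)))"
proof -
  interpret Levy_vanishing_at_0 H E X
  proof (intro Levy_vanishing_at_0.intro Levy_vanishing_at_0_axioms.intro)
    show "Levy_process H E X" using assms(2) by (simp add: G_Levy_process_def)
    show "((\<lambda>t. E (\<lambda>\<omega>. norm (X t \<omega>))) \<longlongrightarrow> 0) (at_right 0)"
      by (rule G_Levy_norm_tendsto_0[OF assms(1,2)])
  qed (rule assms(1))
  have "generator = G_gen E X" by (simp add: fun_eq_iff generator_def G_gen_def)
  moreover have "lipschitz_fun \<phi>" using assms(4) by (auto simp: lipschitz_fun_def)
  ultimately show ?thesis using value_is_viscosity_solution[OF assms(3)] by simp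
qed

end
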